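(* Let $K$ be an origin-symmetric star body in $\mathbb{R}^n$. If the space $(\mathbb{R}^n,\|\cdot\|_K)$ embeds in $L_{p_0}$ for some $0<p_0\le 2$, then it also embeds in $L_0$.
   Context: An origin-symmetric star body in $\mathbb{R}^n$ is a compact set $K$, symmetric about the origin, such that every straight line through the origin crosses the boundary of $K$ at exactly two points, the boundary is continuous (i.e. the radial function $x\mapsto\|x\|_K^{-1}$ is continuous on $S^{n-1}$), and the origin is an interior point of $K$. Its Minkowski functional is $\|x\|_K=\min\{a\ge 0: x\in aK\}$. The space $(\mathbb{R}^n,\|\cdot\|_K)$ embeds in $L_0$ if there exist a finite Borel (non-negative) measure $\mu$ on $S^{n-1}$ and a constant $C\in\mathbb{R}$ such that for every $x\in\mathbb{R}^n$, $\ln\|x\|_K=\int_{S^{n-1}}\ln|(x,\xi)|\,d\mu(\xi)+C$. For $p>0$, the space embeds in $L_p$ if and only if there is a finite Borel (non-negative) measure $\mu$ on $S^{n-1}$ such that for every $x\in\mathbb{R}^n$, $\|x\|_K^p=\int_{S^{n-1}}|(x,\xi)|^p\,d\mu(\xi)$. *)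

theory Defs
  imports "HOL-Analysis.Analysis"
begin

definition minkowski_functional :: "(real ^ 'n) set \<Rightarrow> real ^ 'n \<Rightarrow> real" where
  "minkowski_functional K x = (LEAST a. 0 \<le> a \<and> x \<in> (\<lambda>y. a *\<^sub>R y) ` K)"

definition origin_symmetric_star_body :: "(real ^ 'n) set \<Rightarrow> bool" where
  "origin_symmetric_star_body K \<longleftrightarrow>
     compact K \<and>
     (\<forall>x\<in>K. - x \<in> K) \<and>
     (\<forall>u. u \<noteq> 0 \<longrightarrow> card ({t *\<^sub>R u | t. t \<in> (UNIV :: real set)} \<inter> frontier K) = 2) \<and>
     continuous_on (sphere 0 1) (\<lambda>x. inverse (minkowski_functional K x)) \<and>
     0 \<in> interior K"

definition finite_borel_measure_on_sphere :: "(real ^ 'n) measure \<Rightarrow> bool" where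
  "finite_borel_measure_on_sphere \<mu> \<longleftrightarrow>
     finite_measure \<mu> \<and> sets \<mu> = sets (restrict_space borel (sphere 0 1))"

text \<open>
  The logarithm on \<open>[0, \<infinity>)\<close> with \<open>ln 0 = -\<infinity>\<close>. The library has \<open>ln 0 = 0\<close> on the reals,
  which would make \<open>ln \<bar>x \<bullet> \<xi>\<bar>\<close> ignore the mass that a measure puts on the hyperplane
  orthogonal to \<open>x\<close>.
\<close>
definition eln :: "real \<Rightarrow> ereal" where
  "eln t = (if t = 0 then - \<infinity> else ereal (ln t))"

text \<open>
  The Lebesgue integral of an extended real function, as the integral of the positive part minus
  the integral of the negative part (\<open>e2ennreal\<close> maps negative numbers to \<open>0\<close>). The Bochner
  integral does not apply here, since it is \<open>0\<close> for non-integrable functions. The undefined case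
  \<open>\<infinity> - \<infinity>\<close> does not arise below: \<open>ln \<bar>x \<bullet> \<xi>\<bar>\<close> is bounded above for \<open>\<xi>\<close> on the sphere.
\<close>
definition ereal_integral :: "'a measure \<Rightarrow> ('a \<Rightarrow> ereal) \<Rightarrow> ereal" where
  "ereal_integral M f =
     enn2ereal (\<integral>\<^sup>+ x. e2ennreal (f x) \<partial>M) - enn2ereal (\<integral>\<^sup>+ x. e2ennreal (- f x) \<partial>M)"

text \<open>The equation includes \<open>x = 0\<close>, where the left-hand side is \<open>-\<infinity>\<close>.\<close>
definition embeds_in_L0 :: "(real ^ 'n) set \<Rightarrow> bool" where
  "embeds_in_L0 K \<longleftrightarrow>
     (\<exists>\<mu> C. finite_borel_measure_on_sphere \<mu> \<and>
        (\<forall>x. eln (minkowski_functional K x) =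
               ereal_integral \<mu> (\<lambda>\<xi>. eln \<bar>x \<bullet> \<xi>\<bar>) + ereal C))"

text \<open>
  For \<open>p > 0\<close>; embedding into \<open>L\<^sub>p\<close> is expressed by its Levy representation. The integrand is
  bounded and measurable, hence integrable.
\<close>
definition embeds_in_Lp :: "real \<Rightarrow> (real ^ 'n) set \<Rightarrow> bool" where
  "embeds_in_Lp p K \<longleftrightarrow>
     (\<exists>\<mu>. finite_borel_measure_on_sphere \<mu> \<and>
        (\<forall>x. minkowski_functional K x powr p = (\<integral>\<xi>. \<bar>x \<bullet> \<xi>\<bar> powr p \<partial>\<mu>)))"

end

theory Submission
  imports Defs "HOL-Probability.Probability" "HOL-Real_Asymp.Real_Asymp"
begin

text \<open>
  For \<open>p \<le> 2\<close> the function \<open>exp (- c \<parallel>x\<parallel>\<^sup>p)\<close> is the characteristic function of a random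
  vector \<open>Z\<close>: a Gaussian vector if \<open>p = 2\<close>, and for \<open>p < 2\<close> a sum of independent symmetric
  compound Poisson vectors, one for each dyadic shell of jump sizes of the stable Levy measure.
  Hence all the variables \<open>(x, Z) / \<parallel>x\<parallel>\<close> have the same law, whose logarithm is integrable, and
  the expectation of \<open>ln \<bar>(x, Z)\<bar>\<close> is \<open>ln \<parallel>x\<parallel>\<close> plus a constant. Writing
  \<open>ln \<bar>(x, Z)\<bar> = ln \<bar>Z\<bar> + ln \<bar>(x, Z / \<bar>Z\<bar>)\<bar>\<close> shows that the law of \<open>Z / \<bar>Z\<bar>\<close> on the
  sphere represents the norm in \<open>L\<^sub>0\<close>.
\<close>

subsection \<open>Characteristic functions of laws on Euclidean space\<close>

text \<open>For 0 < p < 2 the construction rests on the formula that the integral of (1 - cos (r s))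
  |r|^(-1-p) dr is a positive constant times |s|^p. Put s = (x, \<xi>) and average over \<xi> with
  respect to the normalised measure that represents the norm in L_p: this writes the exponent as a
  superposition of terms 1 - cos, which are exponents of symmetric compound Poisson laws. The
  obstacle is that the measure of jumps has infinite mass near r = 0, so one compound Poisson law
  cannot do. Each dyadic shell has finite mass, and the second moments of the shells of small jumps
  decay geometrically, which makes the sum over the shells converge. The ratio of this decay tends
  to 1 as p tends to 2, and at p = 2 the jump integral diverges; there the exponent is a quadratic
  form instead. The logarithm suits the argument because it turns the factor
  \<open>minkowski_functional K x\<close>, by which the projections of Z differ in law, into a
  summand. That the logarithm is integrable is deduced from the characteristic function
  alone.\<close>

definition cf :: "'a::euclidean_space measure \<Rightarrow> 'a \<Rightarrow> complex" where
  "cf P x = (CLINT z|P. iexp (x \<bullet> z))"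

lemma cf_distr:
  assumes "f \<in> borel_measurable M"
  shows "cf (distr M borel f) x = (CLINT \<omega>|M. iexp (x \<bullet> f \<omega>))"
  unfolding cf_def using assms by (subst integral_distr) auto

text \<open>Reduces a vector law to its projections on lines, where the one-dimensional uniqueness
  theorem and \<open>ln_abs_integrable\<close> apply.\<close>

lemma char_distr_inner:
  assumes [measurable_cong]: "sets P = sets borel"
  shows "char (distr P borel (\<lambda>z. x \<bullet> z)) t = cf P (t *\<^sub>R x)"
  unfolding char_def cf_def by (subst integral_distr) auto

lemma norm_cf_le_1:
  assumes "prob_space P"
  shows "norm (cf P x) \<le> 1"
proof -
  interpret prob_space P by fact
  have "norm (cf P x) \<le> (\<integral>z. norm (iexp (x \<bullet> z)) \<partial>P)"
    unfolding cf_def by (rule integral_norm_bound)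
  also have "\<dots> \<le> 1" by (simp del: of_real_mult add: prob_space)
  finally show ?thesis .
qed

text \<open>The joint law of all coordinates is the product measure itself, which is also the
  product of the marginals; equality of the two characterises independence.\<close>

lemma indep_vars_PiM_coordinates:
  assumes "\<And>i. i \<in> I \<Longrightarrow> prob_space (M i)" "I \<noteq> {}"
  shows "prob_space.indep_vars (PiM I M) M (\<lambda>i \<omega>. \<omega> i) I"
proof -
  interpret prob_space "PiM I M" using assms by (intro prob_space_PiM)
  have "distr (PiM I M) (PiM I M) (\<lambda>x. \<lambda>i\<in>I. x i) = distr (PiM I M) (PiM I M) (\<lambda>x. x)"
    by (intro distr_cong) (auto simp: space_PiM)
  also have "\<dots> = PiM I M" by (rule distr_id2) simp
  also have "\<dots> = (\<Pi>\<^sub>M i\<in>I. distr (PiM I M) (M i) (\<lambda>\<omega>. \<omega> i))"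
    by (intro PiM_cong refl distr_PiM_component[symmetric] assms)
  finally show ?thesis
    using assms by (subst indep_vars_iff_distr_eq_PiM') auto
qed

lemma cf_PiM_sum:
  fixes P :: "nat \<Rightarrow> 'a::euclidean_space measure"
  assumes P: "\<And>k. prob_space (P k)" and sets[measurable_cong]: "\<And>k. sets (P k) = sets borel"
  shows "(CLINT \<omega>|PiM UNIV P. iexp (x \<bullet> (\<Sum>k<n. \<omega> k))) = (\<Prod>k<n. cf (P k) x)"
proof -
  interpret prob_space "PiM UNIV P" using P by (intro prob_space_PiM)
  have "indep_vars P (\<lambda>k \<omega>. \<omega> k) UNIV"
    using indep_vars_PiM_coordinates[of UNIV P] P by simp
  then have ind: "indep_vars P (\<lambda>k \<omega>. \<omega> k) {..<n}"
    by (rule indep_vars_subset) auto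
  have "(CLINT \<omega>|PiM UNIV P. iexp (x \<bullet> (\<Sum>k<n. \<omega> k)))
      = (CLINT \<omega>|PiM UNIV P. (\<Prod>k<n. iexp (x \<bullet> \<omega> k)))"
    by (simp add: inner_sum_right sum_distrib_left exp_sum)
  also have "\<dots> = (\<Prod>k<n. CLINT \<omega>|PiM UNIV P. iexp (x \<bullet> \<omega> k))"
  proof (rule indep_vars_lebesgue_integral)
    show "indep_vars (\<lambda>_. borel) (\<lambda>k \<omega>. iexp (x \<bullet> \<omega> k)) {..<n}"
      by (rule indep_vars_compose2[OF ind]) measurable
  qed (auto intro!: integrable_iexp)
  also have "\<dots> = (\<Prod>k<n. cf (P k) x)"
  proof (rule prod.cong[OF refl])
    fix k
    have "cf (P k) x = cf (distr (PiM UNIV P) (P k) (\<lambda>\<omega>. \<omega> k)) x"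
      using P by (subst distr_PiM_component) auto
    also have "\<dots> = (CLINT \<omega>|PiM UNIV P. iexp (x \<bullet> \<omega> k))"
      unfolding cf_def by (subst integral_distr) auto
    finally show "(CLINT \<omega>|PiM UNIV P. iexp (x \<bullet> \<omega> k)) = cf (P k) x" by simp
  qed
  finally show ?thesis .
qed

section \<open>Compound Poisson laws\<close>

lemma integral_poisson_power:
  fixes z :: complex
  assumes "0 < r" "norm z \<le> 1"
  shows "(CLINT n|measure_pmf (poisson_pmf r). z ^ n) = exp (r * (z - 1))"
proof -
  have eq: "(CLINT n|measure_pmf (poisson_pmf r). z ^ n)
     = (CLINT n|count_space UNIV. pmf (poisson_pmf r) n *\<^sub>R z ^ n)"
    by (simp add: measure_pmf_eq_density integral_density)
  have int: "integrable (count_space UNIV) (\<lambda>n. pmf (poisson_pmf r) n *\<^sub>R z ^ n)"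
  proof -
    have "integrable (measure_pmf (poisson_pmf r)) (\<lambda>n. z ^ n)"
      by (rule measure_pmf.integrable_const_bound[where B=1])
         (auto simp: norm_power power_le_one assms)
    then show ?thesis by (simp add: measure_pmf_eq_density integrable_density)
  qed
  have "(\<lambda>n. pmf (poisson_pmf r) n *\<^sub>R z ^ n) sums (CLINT n|count_space UNIV. pmf (poisson_pmf r) n *\<^sub>R z ^ n)"
    by (rule sums_integral_count_space_nat[OF int])
  moreover have "(\<lambda>n. pmf (poisson_pmf r) n *\<^sub>R z ^ n) sums (exp (-r) * exp (r * z))"
  proof -
    have "(\<lambda>n. exp (-r) * ((r * z) ^ n /\<^sub>R fact n)) sums (exp (-r) * exp (r * z))"
      by (intro sums_mult exp_converges)
    also have "(\<lambda>n. exp (-r) * ((r * z) ^ n /\<^sub>R fact n)) = (\<lambda>n. pmf (poisson_pmf r) n *\<^sub>R z ^ n)"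
      using assms by (auto simp: scaleR_conv_of_real power_mult_distrib field_simps fun_eq_iff
          simp flip: exp_of_real)
    finally show ?thesis .
  qed
  ultimately have "(CLINT n|count_space UNIV. pmf (poisson_pmf r) n *\<^sub>R z ^ n) = exp (-r) * exp (r * z)"
    by (rule sums_unique2)
  then show ?thesis unfolding eq
    by (simp add: exp_add[symmetric] exp_of_real[symmetric] algebra_simps)
qed

text \<open>Given a Poisson number n of jumps, the sum of n independent jumps of law
  \<open>M\<close> has characteristic function \<open>cf M x ^ n\<close>; averaging over n evaluates
  the Poisson generating function at \<open>cf M x\<close>, a point of the closed unit disc. The
  hypothesis \<open>sym\<close> removes the imaginary part of \<open>cf M x\<close> and leaves the
  cosine integral.\<close>

lemma compound_poisson_exists:
  fixes M :: "'a::euclidean_space measure"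
  assumes M: "prob_space M" and sets[measurable_cong]: "sets M = sets borel" and r: "0 < r"
    and sym: "\<And>x. (\<integral>y. sin (x \<bullet> y) \<partial>M) = 0"
  shows "\<exists>P. prob_space P \<and> sets P = sets borel \<and>
           (\<forall>x. cf P x = of_real (exp (- r * (\<integral>y. (1 - cos (x \<bullet> y)) \<partial>M))))"
proof -
  interpret M: prob_space M by fact
  \<comment> \<open>An infinite sequence of jumps is drawn in advance and the Poisson variable says
    how many of them are added, so that one product space serves every n.\<close>
  let ?\<Pi> = "PiM (UNIV :: nat set) (\<lambda>_. M)" and ?N = "measure_pmf (poisson_pmf r)"
  interpret Pi: prob_space ?\<Pi> using M by (intro prob_space_PiM)
  interpret N: prob_space ?N by (rule measure_pmf.prob_space_axioms)
  interpret NPi: pair_prob_space ?N ?\<Pi> ..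
  let ?S = "\<lambda>(n, y). \<Sum>k<n. y k"
  define P where "P = distr (?N \<Otimes>\<^sub>M ?\<Pi>) borel ?S"
  have [measurable]: "?S \<in> borel_measurable (?N \<Otimes>\<^sub>M ?\<Pi>)"
  proof -
    have "?S \<in> borel_measurable (count_space UNIV \<Otimes>\<^sub>M ?\<Pi>)"
      by (rule measurable_pair_measure_countable1) auto
    also have "measurable (count_space UNIV \<Otimes>\<^sub>M ?\<Pi>) borel = measurable (?N \<Otimes>\<^sub>M ?\<Pi>) borel"
      by (intro measurable_cong_sets sets_pair_measure_cong) auto
    finally show ?thesis .
  qed
  have P: "prob_space P" unfolding P_def by (rule NPi.prob_space_distr) simp
  have "cf P x = of_real (exp (- r * (\<integral>y. (1 - cos (x \<bullet> y)) \<partial>M)))" for x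
  proof -
    have i1: "integrable M (\<lambda>y. cos (x \<bullet> y))" 
      by (rule M.integrable_const_bound[of _ 1]) auto
    have i2: "integrable M (\<lambda>y. sin (x \<bullet> y))" 
      by (rule M.integrable_const_bound[of _ 1]) auto
    have M_cf: "cf M x = of_real (\<integral>y. cos (x \<bullet> y) \<partial>M)"
    proof -
      have i3: "integrable M (\<lambda>y. iexp (x \<bullet> y))" by (rule M.integrable_iexp) auto
      have "Re (cf M x) = (\<integral>y. cos (x \<bullet> y) \<partial>M)" "Im (cf M x) = (\<integral>y. sin (x \<bullet> y) \<partial>M)"
        unfolding cf_def using i3 by (simp_all add: Re_exp Im_exp flip: integral_Re integral_Im)
      then show ?thesis using sym by (simp add: complex_eq_iff)
    qed
    have "cf P x = (CLINT w|?N \<Otimes>\<^sub>M ?\<Pi>. iexp (x \<bullet> ?S w))"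
      unfolding P_def by (rule cf_distr) simp
    also have "\<dots> = (CLINT n|?N. CLINT y|?\<Pi>. iexp (x \<bullet> (\<Sum>k<n. y k)))"
      by (subst NPi.integral_fst'[symmetric])
         (auto intro!: NPi.P.integrable_iexp simp: split_beta)
    also have "\<dots> = (CLINT n|?N. cf M x ^ n)"
      by (subst cf_PiM_sum) (auto simp: M sets)
    also have "\<dots> = exp (r * (cf M x - 1))"
      using r M by (intro integral_poisson_power norm_cf_le_1)
    also have "\<dots> = of_real (exp (- r * (\<integral>y. (1 - cos (x \<bullet> y)) \<partial>M)))"
      using i1 by (simp add: M_cf M.prob_space exp_of_real[symmetric] algebra_simps)
    finally show ?thesis .
  qed
  with P show ?thesis by (intro exI[of _ P]) (auto simp: P_def)
qed

section \<open>Convergent series of independent vectors\<close>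

lemma one_minus_cos_le: "1 - cos u \<le> u\<^sup>2 / 2" for u :: real
proof -
  have "1 - cos u = 2 * (sin (u / 2))\<^sup>2"
    using cos_double_sin[of "u / 2"] by simp
  also have "(sin (u / 2))\<^sup>2 \<le> (u / 2)\<^sup>2"
    using abs_sin_x_le_abs_x[of "u / 2"] by (simp only: abs_le_square_iff)
  finally show ?thesis by (simp add: power2_eq_square)
qed

text \<open>Fatou's lemma for \<open>s\<^sup>2 = lim 2 n\<^sup>2 (1 - cos (s / n))\<close>.\<close>

lemma second_moment_le:
  fixes P :: "'a::euclidean_space measure"
  assumes P: "prob_space P" and sets[measurable_cong]: "sets P = sets borel"
    and cf: "\<And>t. cf P (t *\<^sub>R x) = of_real (exp (- h t))" and h: "\<And>t. h t \<le> t\<^sup>2 * s"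
  shows "(\<integral>\<^sup>+z. ennreal ((x \<bullet> z)\<^sup>2) \<partial>P) \<le> ennreal (2 * s)"
proof -
  interpret prob_space P by fact
  let ?u = "\<lambda>n z. 2 * (real (Suc n))\<^sup>2 * (1 - cos ((x \<bullet> z) / real (Suc n)))"
  have lim: "(\<lambda>n. ?u n z) \<longlonglongrightarrow> (x \<bullet> z)\<^sup>2" for z
  proof -
    have "((\<lambda>y::real. 2 * y\<^sup>2 * (1 - cos (c / y))) \<longlongrightarrow> c\<^sup>2) at_top" for c :: real
      by real_asymp (simp add: power2_eq_square)
    then have "(\<lambda>n. 2 * (real n)\<^sup>2 * (1 - cos ((x \<bullet> z) / real n))) \<longlonglongrightarrow> (x \<bullet> z)\<^sup>2"
      by (rule filterlim_compose) (rule filterlim_real_sequentially)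
    then show ?thesis by (rule LIMSEQ_Suc)
  qed
  have "(\<integral>\<^sup>+z. ennreal ((x \<bullet> z)\<^sup>2) \<partial>P) = (\<integral>\<^sup>+z. liminf (\<lambda>n. ennreal (?u n z)) \<partial>P)"
    by (intro nn_integral_cong lim_imp_Liminf[symmetric] tendsto_ennrealI lim) simp
  also have "\<dots> \<le> liminf (\<lambda>n. \<integral>\<^sup>+z. ennreal (?u n z) \<partial>P)"
    by (rule nn_integral_liminf) simp
  also have "\<dots> \<le> liminf (\<lambda>n. ennreal (2 * s))"
  proof (intro Liminf_mono always_eventually allI)
    fix n
    define t where "t = 1 / real (Suc n)"
    have t: "t \<noteq> 0" by (simp add: t_def)
    have i1: "integrable P (\<lambda>z. cos (t * (x \<bullet> z)))"
      by (rule integrable_const_bound[where B=1]) auto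
    have "Re (cf P (t *\<^sub>R x)) = (\<integral>z. cos (t * (x \<bullet> z)) \<partial>P)"
      unfolding cf_def 
      by (subst integral_Re[symmetric]) (auto intro!: integrable_iexp simp: Re_exp)
    then have c: "(\<integral>z. cos (t * (x \<bullet> z)) \<partial>P) = exp (- h t)" by (simp add: cf)
    have u: "?u n = (\<lambda>z. 2 / t\<^sup>2 * (1 - cos (t * (x \<bullet> z))))"
      by (simp add: t_def power_divide)
    have "(\<integral>\<^sup>+z. ennreal (?u n z) \<partial>P) = ennreal (\<integral>z. ?u n z \<partial>P)"
    proof (rule nn_integral_eq_integral)
      show "integrable P (?u n)" unfolding u using i1 by simp
    qed simp
    also have "(\<integral>z. ?u n z \<partial>P) = 2 / t\<^sup>2 * (1 - exp (- h t))"
      unfolding u using i1 by (simp add: c prob_space)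
    also have "\<dots> \<le> 2 / t\<^sup>2 * (t\<^sup>2 * s)"
    proof (rule mult_left_mono)
      show "1 - exp (- h t) \<le> t\<^sup>2 * s"
        using exp_ge_add_one_self[of "- h t"] h[of t] by linarith
    qed simp
    also have "\<dots> = 2 * s" using t by simp
    finally show "(\<integral>\<^sup>+z. ennreal (?u n z) \<partial>P) \<le> ennreal (2 * s)"
      by (simp add: ennreal_leI)
  qed
  also have "\<dots> = ennreal (2 * s)" by (simp add: Liminf_const)
  finally show ?thesis .
qed

text \<open>Each coordinate u satisfies |u| \<le> u^2 / a + a. Taking the scale a from the second
  moment D a^2 makes the bound linear in a, hence summable when a runs through a geometric
  sequence.\<close>

lemma nn_integral_norm_le:
  fixes P :: "'a::euclidean_space measure" and D a :: real
  assumes P: "prob_space P" and sets[measurable_cong]: "sets P = sets borel"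
    and m: "\<And>b. b \<in> Basis \<Longrightarrow> (\<integral>\<^sup>+z. ennreal ((b \<bullet> z)\<^sup>2) \<partial>P) \<le> ennreal (D * a\<^sup>2)"
    and a: "0 < a" and D: "0 \<le> D"
  shows "(\<integral>\<^sup>+z. ennreal (norm z) \<partial>P) \<le> ennreal (DIM('a) * (D + 1) * a)"
proof -
  interpret prob_space P by fact
  have am: "\<bar>u\<bar> \<le> inverse a * u\<^sup>2 + a" for u :: real
  proof -
    have "0 \<le> (\<bar>u\<bar> - a)\<^sup>2 + a * \<bar>u\<bar>" using a by simp
    then have "a * \<bar>u\<bar> \<le> u\<^sup>2 + a\<^sup>2" by (simp add: power2_eq_square algebra_simps flip: abs_mult)
    then show ?thesis using a by (simp add: field_simps power2_eq_square)
  qed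
  have "(\<integral>\<^sup>+z. ennreal (norm z) \<partial>P)
      \<le> (\<integral>\<^sup>+z. (\<Sum>b\<in>Basis. ennreal (inverse a) * ennreal ((b \<bullet> z)\<^sup>2) + ennreal a) \<partial>P)"
  proof (rule nn_integral_mono)
    fix z :: 'a
    have "norm z \<le> (\<Sum>b\<in>Basis. \<bar>b \<bullet> z\<bar>)"
      using norm_le_l1[of z] by (simp add: inner_commute)
    also have "\<dots> \<le> (\<Sum>b\<in>Basis. inverse a * (b \<bullet> z)\<^sup>2 + a)"
      by (rule sum_mono) (rule am)
    finally have "ennreal (norm z) \<le> ennreal (\<Sum>b\<in>Basis. inverse a * (b \<bullet> z)\<^sup>2 + a)"
      by (rule ennreal_leI)
    also have "\<dots> = (\<Sum>b\<in>Basis. ennreal (inverse a) * ennreal ((b \<bullet> z)\<^sup>2) + ennreal a)"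
      using a by (subst sum_ennreal[symmetric]) (auto simp: ennreal_plus ennreal_mult)
    finally show "ennreal (norm z) \<le> \<dots>" .
  qed
  also have "\<dots> = (\<Sum>b\<in>(Basis::'a set). ennreal (inverse a) * (\<integral>\<^sup>+z. ennreal ((b \<bullet> z)\<^sup>2) \<partial>P) + ennreal a)"
    by (simp add: nn_integral_sum nn_integral_add nn_integral_cmult emeasure_space_1)
  also have "\<dots> \<le> (\<Sum>b\<in>(Basis::'a set). ennreal (inverse a) * ennreal (D * a\<^sup>2) + ennreal a)"
    by (intro sum_mono add_mono mult_left_mono m) auto
  also have "\<dots> = (\<Sum>b\<in>(Basis::'a set). ennreal ((D + 1) * a))"
    using a D
    by (intro sum.cong refl)
       (simp add: ennreal_mult[symmetric] ennreal_plus[symmetric] field_simps power2_eq_square del: ennreal_plus)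
  also have "\<dots> = ennreal (DIM('a) * (D + 1) * a)"
    using a D by (subst sum_ennreal) (auto simp: algebra_simps)
  finally show ?thesis .
qed

text \<open>The bound on \<open>h\<close> controls second moments, so the expected norms decay
  geometrically and the series converges absolutely almost surely; dominated convergence then
  carries the characteristic functions to the limit. The term 0 carries no bound because it will
  hold the large jumps, which may have infinite variance, and a single term cannot affect
  convergence.\<close>

lemma sum_of_independent_exists:
  fixes P :: "nat \<Rightarrow> 'a::euclidean_space measure"
  assumes P: "\<And>k. prob_space (P k)" and sets[measurable_cong]: "\<And>k. sets (P k) = sets borel"
    and cf: "\<And>k x. cf (P k) x = of_real (exp (- h k x))"
    and h: "\<And>k x. h (Suc k) x \<le> (\<sigma> ^ k)\<^sup>2 * (norm x)\<^sup>2"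
    and \<sigma>: "0 < \<sigma>" "\<sigma> < 1"
    and sums: "\<And>x. (\<lambda>k. h k x) sums H x"
  shows "\<exists>Q. prob_space Q \<and> sets Q = sets borel \<and> (\<forall>x. cf Q x = of_real (exp (- H x)))"
proof -
  interpret prob_space "PiM UNIV P" using P by (intro prob_space_PiM)
  have E: "(\<integral>\<^sup>+\<omega>. ennreal (norm (\<omega> (Suc k))) \<partial>PiM UNIV P) \<le> ennreal (DIM('a) * 3 * \<sigma> ^ k)" for k
  proof -
    have "(\<integral>\<^sup>+\<omega>. ennreal (norm (\<omega> (Suc k))) \<partial>PiM UNIV P)
        = (\<integral>\<^sup>+z. ennreal (norm z) \<partial>distr (PiM UNIV P) (P (Suc k)) (\<lambda>\<omega>. \<omega> (Suc k)))"
      by (subst nn_integral_distr) auto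
    also have "\<dots> = (\<integral>\<^sup>+z. ennreal (norm z) \<partial>P (Suc k))"
      using P by (subst distr_PiM_component) auto
    \<comment> \<open>Here \<open>D = 2\<close> is the factor from \<open>second_moment_le\<close>,
      and the scale is \<open>a = \<sigma> ^ k\<close>.\<close>
    also have "\<dots> \<le> ennreal (DIM('a) * (2 + 1 :: real) * \<sigma> ^ k)"
    proof (rule nn_integral_norm_le[OF P sets])
      fix b :: 'a assume b: "b \<in> Basis"
      show "(\<integral>\<^sup>+z. ennreal ((b \<bullet> z)\<^sup>2) \<partial>P (Suc k)) \<le> ennreal (2 * (\<sigma> ^ k)\<^sup>2)"
      proof (rule second_moment_le[OF P sets cf])
        show "h (Suc k) (t *\<^sub>R b) \<le> t\<^sup>2 * (\<sigma> ^ k)\<^sup>2" for t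
          using h[of k "t *\<^sub>R b"] b by (simp add: mult.commute)
      qed
    qed (use \<sigma> in auto)
    finally show ?thesis by simp
  qed
  have "AE \<omega> in PiM UNIV P. (\<Sum>k. ennreal (norm (\<omega> (Suc k)))) \<noteq> \<infinity>"
  proof (rule nn_integral_noteq_infinite)
    have "(\<integral>\<^sup>+\<omega>. (\<Sum>k. ennreal (norm (\<omega> (Suc k)))) \<partial>PiM UNIV P)
        = (\<Sum>k. \<integral>\<^sup>+\<omega>. ennreal (norm (\<omega> (Suc k))) \<partial>PiM UNIV P)"
      by (rule nn_integral_suminf) measurable
    also have "\<dots> \<le> (\<Sum>k. ennreal (DIM('a) * 3 * \<sigma> ^ k))"
      by (intro suminf_le E) auto
    also have "\<dots> < \<infinity>"
      using \<sigma> by (subst suminf_ennreal2) (auto intro!: summable_mult summable_geometric)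
    finally show "(\<integral>\<^sup>+\<omega>. (\<Sum>k. ennreal (norm (\<omega> (Suc k)))) \<partial>PiM UNIV P) \<noteq> \<infinity>" by simp
  qed measurable
  then have conv: "AE \<omega> in PiM UNIV P. (\<lambda>n. \<Sum>k<n. \<omega> k) \<longlonglongrightarrow> (\<Sum>k. \<omega> k)"
  proof eventually_elim
    fix \<omega> :: "nat \<Rightarrow> 'a"
    assume "(\<Sum>k. ennreal (norm (\<omega> (Suc k)))) \<noteq> \<infinity>"
    then have "summable (\<lambda>k. norm (\<omega> (Suc k)))" by (intro summable_suminf_not_top) auto
    then have "summable \<omega>" by (subst summable_Suc_iff[symmetric]) (rule summable_norm_cancel)
    then show "(\<lambda>n. \<Sum>k<n. \<omega> k) \<longlonglongrightarrow> (\<Sum>k. \<omega> k)" by (rule summable_LIMSEQ)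
  qed
  define Q where "Q = distr (PiM UNIV P) borel (\<lambda>\<omega>. \<Sum>k. \<omega> k)"
  have [measurable]: "(\<lambda>\<omega>. \<Sum>k. \<omega> k) \<in> borel_measurable (PiM UNIV P)"
    by measurable
  have "cf Q x = of_real (exp (- H x))" for x
  proof (rule LIMSEQ_unique)
    have "(\<lambda>n. CLINT \<omega>|PiM UNIV P. iexp (x \<bullet> (\<Sum>k<n. \<omega> k)))
       \<longlonglongrightarrow> (CLINT \<omega>|PiM UNIV P. iexp (x \<bullet> (\<Sum>k. \<omega> k)))"
    proof (rule integral_dominated_convergence[where w="\<lambda>_. 1"])
      show "AE \<omega> in PiM UNIV P. (\<lambda>n. iexp (x \<bullet> (\<Sum>k<n. \<omega> k))) \<longlonglongrightarrow> iexp (x \<bullet> (\<Sum>k. \<omega> k))"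
        using conv by eventually_elim (intro tendsto_intros)
    qed (auto simp del: of_real_sum)
    then show "(\<lambda>n. CLINT \<omega>|PiM UNIV P. iexp (x \<bullet> (\<Sum>k<n. \<omega> k))) \<longlonglongrightarrow> cf Q x"
      unfolding Q_def by (subst cf_distr) auto
    have "(\<lambda>n. of_real (exp (- (\<Sum>k<n. h k x))) :: complex) \<longlonglongrightarrow> of_real (exp (- H x))"
      using sums[of x] unfolding sums_def by (intro tendsto_intros)
    also have "(\<lambda>n. of_real (exp (- (\<Sum>k<n. h k x))) :: complex)
        = (\<lambda>n. CLINT \<omega>|PiM UNIV P. iexp (x \<bullet> (\<Sum>k<n. \<omega> k)))"
      by (subst cf_PiM_sum[OF P sets]) (simp add: cf exp_sum sum_negf[symmetric])
    finally show "(\<lambda>n. CLINT \<omega>|PiM UNIV P. iexp (x \<bullet> (\<Sum>k<n. \<omega> k))) \<longlonglongrightarrow> of_real (exp (- H x))" .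
  qed
  then show ?thesis
    by (intro exI[of _ Q]) (auto simp: Q_def prob_space_distr)
qed

subsection \<open>Gaussian vectors\<close>

definition bilinear_psd :: "('a::euclidean_space \<Rightarrow> 'a \<Rightarrow> real) \<Rightarrow> bool" where
  "bilinear_psd f \<longleftrightarrow> (\<forall>y. linear (\<lambda>x. f x y)) \<and> (\<forall>x y. f x y = f y x) \<and> (\<forall>x. 0 \<le> f x x)"

text \<open>The quadratic f (x - t y) (x - t y) is nonnegative at its minimiser t = f x y / f y y.
  The form may be degenerate, so f y y = 0 is a separate case.\<close>

lemma bilinear_psd_cauchy_schwarz:
  assumes f: "bilinear_psd f"
  shows "(f x y)\<^sup>2 \<le> f x x * f y y"
proof -
  have lin: "linear (\<lambda>x. f x y)" for y using f by (simp add: bilinear_psd_def)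
  have sym: "f x y = f y x" for x y using f by (simp add: bilinear_psd_def)
  have nonneg: "0 \<le> f x x" for x using f by (simp add: bilinear_psd_def)
  have exp: "f (x - t *\<^sub>R y) (x - t *\<^sub>R y) = f x x - 2 * t * f x y + t\<^sup>2 * f y y" for t
  proof -
    have "f (x - t *\<^sub>R y) z = f x z - t * f y z" for z
      using linear_diff[OF lin[of z], of x "t *\<^sub>R y"] linear_cmul[OF lin[of z], of t y] by simp
    from this[of "x - t *\<^sub>R y"] this[of x] this[of y] show ?thesis
      using sym[of x "x - t *\<^sub>R y"] sym[of y "x - t *\<^sub>R y"] sym[of y x]
      by (simp add: algebra_simps power2_eq_square)
  qed
  show ?thesis
  proof (cases "f y y = 0")
    case True
    have "f x y = 0"
    proof (rule ccontr)
      assume n: "f x y \<noteq> 0"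
      \<comment> \<open>The expansion is now affine in t, and this t gives it the value -1.\<close>
      have "0 \<le> f x x - 2 * ((f x x + 1) / (2 * f x y)) * f x y"
        using exp[of "(f x x + 1) / (2 * f x y)"] nonneg True by (metis add.right_neutral mult_zero_right)
      then show False using n by simp
    qed
    then show ?thesis using nonneg True by simp
  next
    case False
    then have pos: "0 < f y y" using nonneg[of y] by simp
    have "0 \<le> f x x - 2 * (f x y / f y y) * f x y + (f x y / f y y)\<^sup>2 * f y y"
      using exp[of "f x y / f y y"] nonneg by metis
    also have "\<dots> = f x x - (f x y)\<^sup>2 / f y y"
      using pos by (simp add: field_simps power2_eq_square)
    finally show ?thesis using pos by (simp add: field_simps)
  qed
qed

text \<open>Cholesky elimination, one basis vector at a time.\<close>

lemma bilinear_psd_sum_of_squares_step: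
  fixes f :: "'a::euclidean_space \<Rightarrow> 'a \<Rightarrow> real"
  assumes f: "bilinear_psd f" and "finite B"
  shows "\<exists>vs. bilinear_psd (\<lambda>x y. f x y - (\<Sum>v\<leftarrow>vs. (x \<bullet> v) * (y \<bullet> v))) \<and>
           (\<forall>b\<in>B. \<forall>x. f x b - (\<Sum>v\<leftarrow>vs. (x \<bullet> v) * (b \<bullet> v)) = 0)"
  using \<open>finite B\<close>
proof (induction B)
  case empty
  then show ?case using f by (intro exI[of _ "[]"]) simp
next
  case (insert c B)
  then obtain vs where vs: "bilinear_psd (\<lambda>x y. f x y - (\<Sum>v\<leftarrow>vs. (x \<bullet> v) * (y \<bullet> v)))"
      "\<forall>b\<in>B. \<forall>x. f x b - (\<Sum>v\<leftarrow>vs. (x \<bullet> v) * (b \<bullet> v)) = 0" by auto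
  define r where "r = (\<lambda>x y. f x y - (\<Sum>v\<leftarrow>vs. (x \<bullet> v) * (y \<bullet> v)))"
  have r: "bilinear_psd r" using vs(1) by (simp add: r_def)
  have rB: "r x b = 0" if "b \<in> B" for b x using vs(2) that by (simp add: r_def)
  have lin: "linear (\<lambda>x. r x y)" for y using r by (simp add: bilinear_psd_def)
  have sym: "r x y = r y x" for x y using r by (simp add: bilinear_psd_def)
  have nonneg: "0 \<le> r x x" for x using r by (simp add: bilinear_psd_def)
  note cs = bilinear_psd_cauchy_schwarz[OF r]
  show ?case
  proof (cases "r c c = 0")
    case True
    \<comment> \<open>By Cauchy-Schwarz a zero on the diagonal already clears the whole column, so
      no vector has to be added.\<close>
    have "r x c = 0" for x using cs[of x c] True by simp
    then show ?thesis using vs r unfolding r_def by (intro exI[of _ vs]) simp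
  next
    case False
    then have pos: "0 < r c c" using nonneg[of c] by simp
    \<comment> \<open>The vector representing the functional r x c / sqrt (r c c); subtracting (x,
      v) (y, v) passes to the Schur complement of \<open>r\<close> with respect to
      \<open>c\<close>.\<close>
    define v where "v = (\<Sum>i\<in>Basis. (r i c / sqrt (r c c)) *\<^sub>R i)"
    have v: "x \<bullet> v = r x c / sqrt (r c c)" for x
    proof -
      have "r x c = (\<Sum>i\<in>Basis. (x \<bullet> i) * r i c)"
        using Linear_Algebra.linear_componentwise[OF lin[of c], of x 1] by simp
      then show ?thesis
        by (simp add: v_def inner_sum_right sum_divide_distrib mult.commute)
    qed
    have s: "f x y - (\<Sum>v\<leftarrow>v # vs. (x \<bullet> v) * (y \<bullet> v)) = r x y - r x c * r y c / r c c" for x y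
      using pos by (simp add: r_def v)
    have "bilinear_psd (\<lambda>x y. r x y - r x c * r y c / r c c)"
      unfolding bilinear_psd_def
    proof (intro conjI allI)
      fix y
      have "linear (\<lambda>x. r x y - (r y c / r c c) *\<^sub>R r x c)"
        by (intro linear_compose_sub linear_compose_scale_right lin)
      then show "linear (\<lambda>x. r x y - r x c * r y c / r c c)"
        by (simp add: mult.commute)
    next
      fix x y show "r x y - r x c * r y c / r c c = r y x - r y c * r x c / r c c"
        using sym[of x y] by simp
    next
      fix x show "0 \<le> r x x - r x c * r x c / r c c"
        using cs[of x c] pos by (simp add: field_simps power2_eq_square)
    qed
    \<comment> \<open>Columns cleared earlier stay clear: for b in \<open>B\<close> symmetry also
      gives r b c = 0.\<close>
    moreover have "r x b - r x c * r b c / r c c = 0" if "b \<in> insert c B" for x b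
      using that pos rB sym[of b c] by auto
    ultimately show ?thesis
      by (intro exI[of _ "v # vs"]) (simp only: s, blast)
  qed
qed

lemma bilinear_psd_sum_of_squares:
  fixes f :: "'a::euclidean_space \<Rightarrow> 'a \<Rightarrow> real"
  assumes f: "bilinear_psd f"
  shows "\<exists>vs. \<forall>x. f x x = (\<Sum>v\<leftarrow>vs. (x \<bullet> v)\<^sup>2)"
proof -
  obtain vs where vs: "bilinear_psd (\<lambda>x y. f x y - (\<Sum>v\<leftarrow>vs. (x \<bullet> v) * (y \<bullet> v)))"
      "\<forall>b\<in>Basis. \<forall>x. f x b - (\<Sum>v\<leftarrow>vs. (x \<bullet> v) * (b \<bullet> v)) = 0"
    using bilinear_psd_sum_of_squares_step[OF f finite_Basis] by blast
  define r where "r = (\<lambda>x y. f x y - (\<Sum>v\<leftarrow>vs. (x \<bullet> v) * (y \<bullet> v)))"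
  have r: "linear (\<lambda>x. r x y)" "r x y = r y x" for x y
    using vs(1) unfolding bilinear_psd_def r_def by blast+
  have "r x y = 0" for x y
  proof -
    have "r x y = (\<Sum>i\<in>Basis. (x \<bullet> i) * r i y)"
      using Linear_Algebra.linear_componentwise[OF r(1)[of y], of x 1] by simp
    also have "\<dots> = 0"
      using vs(2) r(2)[of _ y] by (intro sum.neutral) (simp add: r_def)
    finally show ?thesis .
  qed
  then have "f x x = (\<Sum>v\<leftarrow>vs. (x \<bullet> v)\<^sup>2)" for x
    using r_def by (simp add: power2_eq_square)
  then show ?thesis by blast
qed

text \<open>If f x x is the sum of the squares (x, v)^2, then the vectors v with independent
  standard normal coefficients add up to a Gaussian vector whose variance in direction x is f x
  x.\<close>

lemma gaussian_exists:
  fixes f :: "'a::euclidean_space \<Rightarrow> 'a \<Rightarrow> real"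
  assumes f: "bilinear_psd f"
  shows "\<exists>Q. prob_space Q \<and> sets Q = sets borel \<and> (\<forall>x. cf Q x = of_real (exp (- (f x x / 2))))"
proof -
  obtain vs where vs: "\<And>x. f x x = (\<Sum>v\<leftarrow>vs. (x \<bullet> v)\<^sup>2)"
    using bilinear_psd_sum_of_squares[OF f] by blast
  interpret G: real_distribution std_normal_distribution by (rule real_dist_normal_dist)
  \<comment> \<open>Past \<open>length vs\<close> the entry \<open>vs ! k\<close> is an arbitrary
    vector. Any choice gives a probability law, and only the first \<open>length vs\<close>
    coordinates are summed.\<close>
  define P where "P k = distr std_normal_distribution borel (\<lambda>g. g *\<^sub>R (vs ! k))" for k
  have P: "prob_space (P k)" for k unfolding P_def by (rule G.prob_space_distr) simp
  have sets[measurable_cong]: "sets (P k) = sets borel" for k by (simp add: P_def)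
  have cfP: "cf (P k) x = of_real (exp (- ((x \<bullet> (vs ! k))\<^sup>2 / 2)))" for k x
  proof -
    have "cf (P k) x = char std_normal_distribution (x \<bullet> (vs ! k))"
      unfolding P_def by (subst cf_distr) (auto simp: char_def mult.commute)
    then show ?thesis by (simp add: char_std_normal_distribution)
  qed
  interpret prob_space "PiM UNIV P" using P by (intro prob_space_PiM)
  define Q where "Q = distr (PiM UNIV P) borel (\<lambda>\<omega>. \<Sum>k<length vs. \<omega> k)"
  have "cf Q x = of_real (exp (- (f x x / 2)))" for x
  proof -
    have "cf Q x = (CLINT \<omega>|PiM UNIV P. iexp (x \<bullet> (\<Sum>k<length vs. \<omega> k)))"
      unfolding Q_def by (rule cf_distr) measurable
    also have "\<dots> = (\<Prod>k<length vs. of_real (exp (- ((x \<bullet> (vs ! k))\<^sup>2 / 2))))"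
      by (subst cf_PiM_sum[OF P sets]) (simp add: cfP)
    also have "\<dots> = of_real (exp (- ((\<Sum>k<length vs. (x \<bullet> (vs ! k))\<^sup>2) / 2)))"
      by (simp add: exp_sum[symmetric] sum_negf[symmetric] sum_divide_distrib flip: of_real_prod)
    also have "(\<Sum>k<length vs. (x \<bullet> (vs ! k))\<^sup>2) = f x x"
      by (simp add: vs sum_list_sum_nth atLeast0LessThan)
    finally show ?thesis .
  qed
  then show ?thesis
    by (intro exI[of _ Q]) (auto simp: Q_def intro!: prob_space_distr)
qed

subsection \<open>Logarithmic moments of stable laws\<close>

text \<open>Both sides are the expectation of exp (i v g s), with s of law \<open>M\<close> and g an
  independent standard normal variable, integrated in the two possible orders.\<close>

lemma (in real_distribution) gaussian_smoothing:
  "complex_of_real (\<integral>s. exp (- ((v * s)\<^sup>2 / 2)) \<partial>M) = (CLINT g|std_normal_distribution. char M (v * g))"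
proof -
  interpret G: real_distribution std_normal_distribution by (rule real_dist_normal_dist)
  interpret GM: pair_prob_space std_normal_distribution M ..
  have [measurable_cong]: "sets std_normal_distribution = sets borel" by simp
  have int: "integrable (std_normal_distribution \<Otimes>\<^sub>M M) (\<lambda>(g, s). iexp (v * g * s))"
    unfolding split_beta by (rule GM.P.integrable_iexp) (simp_all add: split_beta)
  have "(CLINT g|std_normal_distribution. char M (v * g))
      = (CLINT g|std_normal_distribution. CLINT s|M. iexp (v * g * s))"
    by (simp add: char_def)
  also have "\<dots> = (CLINT s|M. CLINT g|std_normal_distribution. iexp (v * g * s))"
    using GM.Fubini_integral[OF int] by simp
  also have "\<dots> = (CLINT s|M. char std_normal_distribution (v * s))"
    by (simp add: char_def mult_ac)
  also have "\<dots> = complex_of_real (\<integral>s. exp (- ((v * s)\<^sup>2 / 2)) \<partial>M)"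
    by (simp add: char_std_normal_distribution)
  finally show ?thesis by simp
qed

text \<open>An integrable majorant. With y = c |u|^p, the inequality z \<le> exp z at z = y p / 2,
  raised to the power 2 / p, has exactly exp y on the right and a multiple of u^2 on the
  left.\<close>

lemma exp_neg_powr_le:
  fixes u :: real
  assumes "0 < c" "0 < p"
  shows "exp (- (c * \<bar>u\<bar> powr p)) \<le> (1 + 1 / (c * p / 2) powr (2 / p)) * inverse (1 + u\<^sup>2)"
proof -
  define L where "L = (c * p / 2) powr (2 / p)"
  define y where "y = c * \<bar>u\<bar> powr p"
  have L: "0 < L" using assms by (simp add: L_def)
  have y: "0 \<le> y" using assms by (simp add: y_def)
  have "L * u\<^sup>2 = (y * p / 2) powr (2 / p)"
    using assms by (simp add: L_def y_def powr_mult powr_divide powr_powr)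
  also have "\<dots> \<le> exp (y * p / 2) powr (2 / p)"
  proof (rule powr_mono2)
    show "y * p / 2 \<le> exp (y * p / 2)" using exp_ge_add_one_self[of "y * p / 2"] by linarith
  qed (use assms y in auto)
  also have "\<dots> = exp y" using assms by (simp add: powr_def)
  finally have "u\<^sup>2 \<le> exp y / L" using L by (simp add: field_simps)
  moreover have "1 \<le> exp y" using y by simp
  ultimately have "1 + u\<^sup>2 \<le> exp y + exp y / L" by linarith
  then have "1 + u\<^sup>2 \<le> (1 + 1 / L) * exp y" by (simp add: algebra_simps)
  moreover have "0 < 1 + u\<^sup>2" by (simp add: add_pos_nonneg)
  ultimately have "exp (- y) \<le> (1 + 1 / L) * inverse (1 + u\<^sup>2)"
    by (simp add: exp_minus field_simps)
  then show ?thesis by (simp add: y_def L_def)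
qed

lemma exp_neg_powr_integral_finite:
  assumes "0 < c" "0 < p"
  shows "(\<integral>\<^sup>+u. ennreal (exp (- (c * \<bar>u\<bar> powr p))) \<partial>lborel) < \<infinity>"
proof -
  define K where "K = 1 + 1 / (c * p / 2) powr (2 / p)"
  have "integrable lborel (\<lambda>u::real. K * inverse (1 + u\<^sup>2))"
    using integrable_inverse_1_plus_square by (simp add: set_integrable_def einterval_eq_UNIV)
  then have "(\<integral>\<^sup>+u. ennreal (K * inverse (1 + u\<^sup>2)) \<partial>lborel) < \<infinity>"
    unfolding integrable_iff_bounded
    by (elim conjE order.strict_trans1[rotated], intro nn_integral_mono ennreal_leI) simp
  then show ?thesis
    using exp_neg_powr_le[OF assms]
    by (elim order.strict_trans1[rotated]) (intro nn_integral_mono ennreal_leI, simp add: K_def)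
qed

text \<open>At least log2 t of the numbers t / 2^n are \<ge> 1, and each contributes at least
  \<kappa>; moreover ln t \<le> log2 t because ln 2 \<le> 1.\<close>

lemma ln_le_dyadic_sum:
  assumes "1 \<le> t" "\<And>u. 1 \<le> u \<Longrightarrow> \<kappa> \<le> g u" "0 \<le> \<kappa>"
  shows "ennreal (\<kappa> * ln t) \<le> (\<Sum>n. ennreal (g (t / 2 ^ n)))"
proof -
  define m where "m = nat \<lfloor>log 2 t\<rfloor>"
  have l: "0 \<le> log 2 t" using assms by simp
  have "ln t = log 2 t * ln 2" by (simp add: log_def)
  also have "\<dots> \<le> log 2 t * 1" using l ln_le_minus_one[of 2] by (intro mult_left_mono) auto
  also have "\<dots> \<le> real (Suc m)" unfolding m_def using l by linarith
  finally have "\<kappa> * ln t \<le> \<kappa> * real (Suc m)" using assms by (intro mult_left_mono)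
  then have "ennreal (\<kappa> * ln t) \<le> ennreal (\<Sum>n\<le>m. \<kappa>)" by (intro ennreal_leI) (simp add: mult.commute)
  also have "\<dots> = (\<Sum>n\<le>m. ennreal \<kappa>)" using assms by (subst sum_ennreal) auto
  also have "\<dots> \<le> (\<Sum>n\<le>m. ennreal (g (t / 2 ^ n)))"
  proof (intro sum_mono ennreal_leI assms(2))
    fix n assume "n \<in> {..m}"
    then have "real n \<le> log 2 t" unfolding m_def using l by (simp add: le_nat_iff) linarith
    then have "2 powr real n \<le> t" using assms by (subst (asm) le_log_iff) auto
    then show "1 \<le> t / 2 ^ n" by (simp add: powr_realpow)
  qed
  also have "\<dots> \<le> (\<Sum>n. ennreal (g (t / 2 ^ n)))"
    by (rule sum_le_suminf) auto
  finally show ?thesis .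
qed

text \<open>The first sum serves |s| \<ge> 1, with g u = 1 - exp (-u^2 / 2); the second serves |s| <
  1, with t = 1 / |s| and g u = exp (-1 / (2 u^2)). Both functions g increase for u \<ge> 1, and
  \<kappa> is the smaller of their values at u = 1.\<close>

lemma abs_ln_le_dyadic_sums:
  fixes s :: real
  assumes s: "s \<noteq> 0" and \<kappa>: "\<kappa> = 1 - exp (- (1 / 2))"
  shows "ennreal (\<kappa> * \<bar>ln \<bar>s\<bar>\<bar>) \<le> (\<Sum>n. ennreal (1 - exp (- ((1 / 2 ^ n * s)\<^sup>2 / 2))))
            + (\<Sum>n. ennreal (exp (- ((2 ^ n * s)\<^sup>2 / 2))))"
proof -
  have \<kappa>0: "0 \<le> \<kappa>" using \<kappa> by simp
  have \<kappa>1: "\<kappa> \<le> exp (- (1 / 2))" using exp_ge_add_one_self[of "- (1 / 2)"] \<kappa> by simp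
  show ?thesis
  proof (cases "1 \<le> \<bar>s\<bar>")
    case True
    have "ennreal (\<kappa> * ln \<bar>s\<bar>) \<le> (\<Sum>n. ennreal (1 - exp (- ((\<bar>s\<bar> / 2 ^ n)\<^sup>2 / 2))))"
    proof (rule ln_le_dyadic_sum[OF True _ \<kappa>0])
      fix u :: real assume "1 \<le> u"
      then have "1 \<le> u\<^sup>2" by simp
      then show "\<kappa> \<le> 1 - exp (- (u\<^sup>2 / 2))" by (simp add: \<kappa>)
    qed
    then show ?thesis using True by (simp add: power_divide add_increasing2)
  next
    case False
    have "ennreal (\<kappa> * ln (1 / \<bar>s\<bar>)) \<le> (\<Sum>n. ennreal (exp (- ((1 / (1 / \<bar>s\<bar> / 2 ^ n))\<^sup>2 / 2))))"
    proof (rule ln_le_dyadic_sum[OF _ _ \<kappa>0])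
      fix u :: real assume "1 \<le> u"
      then have "(1 / u)\<^sup>2 \<le> 1" by (simp add: power_divide)
      then have "exp (- (1 / 2)) \<le> exp (- ((1 / u)\<^sup>2 / 2))"
        by (simp only: exp_le_cancel_iff)
      with \<kappa>1 show "\<kappa> \<le> exp (- ((1 / u)\<^sup>2 / 2))" by linarith
    next
      show "1 \<le> 1 / \<bar>s\<bar>" using False s by simp
    qed
    moreover have "\<bar>ln \<bar>s\<bar>\<bar> = ln (1 / \<bar>s\<bar>)" using False s by (simp add: ln_div)
    ultimately show ?thesis using s by (simp add: power_mult_distrib mult.commute add_increasing)
  qed
qed

text \<open>Gaussian smoothing expresses the expectation of \<open>exp (- (v s)\<^sup>2 / 2)\<close> through the characteristic
  function: it is \<open>1 - O(v\<^sup>p)\<close> for small \<open>v\<close> and \<open>O(1 / v)\<close> for large \<open>v\<close>, so both dyadic sums that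
  dominate \<open>\<bar>ln \<bar>s\<bar>\<bar>\<close> have finite expectation.\<close>

lemma (in real_distribution) ln_abs_integrable:
  assumes c: "0 < c" and p: "0 < p" "p \<le> 2"
    and char: "\<And>t. char M t = of_real (exp (- (c * \<bar>t\<bar> powr p)))"
  shows "AE s in M. s \<noteq> 0" and "integrable M (\<lambda>s. ln \<bar>s\<bar>)"
proof -
  interpret G: real_distribution std_normal_distribution by (rule real_dist_normal_dist)
  have F: "(\<integral>s. exp (- ((v * s)\<^sup>2 / 2)) \<partial>M) = (\<integral>g. exp (- (c * \<bar>v * g\<bar> powr p)) \<partial>std_normal_distribution)" for v
  proof -
    have "complex_of_real (\<integral>s. exp (- ((v * s)\<^sup>2 / 2)) \<partial>M)
        = complex_of_real (\<integral>g. exp (- (c * \<bar>v * g\<bar> powr p)) \<partial>std_normal_distribution)"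
      unfolding gaussian_smoothing char by simp
    then show ?thesis using of_real_eq_iff by blast
  qed
  have int1: "integrable M (\<lambda>s. exp (- ((v * s)\<^sup>2 / 2)))" for v
    by (rule integrable_const_bound[where B=1]) auto
  have int2: "integrable std_normal_distribution (\<lambda>g. exp (- (c * \<bar>v * g\<bar> powr p)))" for v
    using c by (intro G.integrable_const_bound[where B=1]) auto
  have int3: "integrable std_normal_distribution (\<lambda>g. 1 + g\<^sup>2)"
    using integrable_std_normal_distribution_moment[of 2] by simp
  define m2 where "m2 = (\<integral>g. 1 + g\<^sup>2 \<partial>std_normal_distribution)"
  have m2: "0 \<le> m2" unfolding m2_def by (rule Bochner_Integration.integral_nonneg) simp
  have small: "(\<integral>s. 1 - exp (- ((v * s)\<^sup>2 / 2)) \<partial>M) \<le> c * m2 * v powr p" if v: "0 < v" for v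
  proof -
    have "(\<integral>s. 1 - exp (- ((v * s)\<^sup>2 / 2)) \<partial>M) = (\<integral>g. 1 - exp (- (c * \<bar>v * g\<bar> powr p)) \<partial>std_normal_distribution)"
      using int1[of v] int2[of v] F[of v] prob_space G.prob_space by simp
    also have "\<dots> \<le> (\<integral>g. (c * v powr p) * (1 + g\<^sup>2) \<partial>std_normal_distribution)"
    proof (rule integral_mono)
      fix g :: real
      have "1 - exp (- (c * \<bar>v * g\<bar> powr p)) \<le> c * \<bar>v * g\<bar> powr p"
        using exp_ge_add_one_self[of "- (c * \<bar>v * g\<bar> powr p)"] by linarith
      also have "\<dots> = (c * v powr p) * \<bar>g\<bar> powr p" using v by (simp add: abs_mult powr_mult)
      \<comment> \<open>Here p \<le> 2 enters: the second Gaussian moment controls the p-th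
        one.\<close>
      also have "\<bar>g\<bar> powr p \<le> 1 + g\<^sup>2"
      proof (cases "\<bar>g\<bar> \<le> 1")
        case True
        then have "\<bar>g\<bar> powr p \<le> 1" using p by (intro powr_le1) auto
        then show ?thesis by (simp add: add_increasing2)
      next
        case False
        then have "\<bar>g\<bar> powr p \<le> \<bar>g\<bar> powr 2" using p by (intro powr_mono) auto
        also have "\<dots> = g\<^sup>2" using False by (simp add: powr_numeral)
        finally show ?thesis by simp
      qed
      finally show "1 - exp (- (c * \<bar>v * g\<bar> powr p)) \<le> (c * v powr p) * (1 + g\<^sup>2)"
        using c by (simp add: mult_left_mono)
    qed (use int2[of v] int3 in auto)
    also have "\<dots> = c * m2 * v powr p" by (simp add: m2_def mult_ac)
    finally show ?thesis .
  qed
  define J where "J = (\<integral>\<^sup>+u. ennreal (exp (- (c * \<bar>u\<bar> powr p))) \<partial>lborel)"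
  have J: "J < \<infinity>" unfolding J_def by (rule exp_neg_powr_integral_finite) fact+
  have large: "(\<integral>\<^sup>+s. ennreal (exp (- ((v * s)\<^sup>2 / 2))) \<partial>M) \<le> ennreal (1 / v) * J" if v: "0 < v" for v
  proof -
    have "(\<integral>\<^sup>+s. ennreal (exp (- ((v * s)\<^sup>2 / 2))) \<partial>M)
        = (\<integral>\<^sup>+g. ennreal (exp (- (c * \<bar>v * g\<bar> powr p))) \<partial>std_normal_distribution)"
      using int1[of v] int2[of v] F[of v] by (simp add: nn_integral_eq_integral)
    also have "\<dots> = (\<integral>\<^sup>+g. ennreal (std_normal_density g) * ennreal (exp (- (c * \<bar>v * g\<bar> powr p))) \<partial>lborel)"
      by (subst nn_integral_density) auto
    \<comment> \<open>Bounding the normal density by 1 leaves a Lebesgue integral, and the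
      substitution u = v g turns it into \<open>J\<close> divided by v.\<close>
    also have "\<dots> \<le> (\<integral>\<^sup>+g. 1 * ennreal (exp (- (c * \<bar>v * g\<bar> powr p))) \<partial>lborel)"
    proof (intro nn_integral_mono mult_right_mono)
      fix g :: real
      have "1 \<le> sqrt (2 * pi)" using pi_gt3 by (intro real_le_rsqrt) simp
      moreover have "exp (- (g\<^sup>2 / 2)) \<le> 1" by simp
      ultimately have "std_normal_density g \<le> 1"
        unfolding std_normal_density_def by (intro mult_le_one) auto
      then show "ennreal (std_normal_density g) \<le> 1" by (simp add: ennreal_le_1)
    qed simp
    also have "\<dots> = ennreal (1 / v) * (ennreal v * (\<integral>\<^sup>+g. ennreal (exp (- (c * \<bar>v * g\<bar> powr p))) \<partial>lborel))"
      using v by (simp add: mult.assoc[symmetric] ennreal_mult[symmetric])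
    also have "ennreal v * (\<integral>\<^sup>+g. ennreal (exp (- (c * \<bar>v * g\<bar> powr p))) \<partial>lborel) = J"
      unfolding J_def using v
      by (subst (2) nn_integral_real_affine[where c=v and t=0]) auto
    finally show ?thesis .
  qed
  let ?A = "\<lambda>s::real. \<Sum>n. ennreal (1 - exp (- ((1 / 2 ^ n * s)\<^sup>2 / 2)))"
  let ?B = "\<lambda>s::real. \<Sum>n. ennreal (exp (- ((2 ^ n * s)\<^sup>2 / 2)))"
  have A: "(\<integral>\<^sup>+s. ?A s \<partial>M) < \<infinity>"
  proof -
    have "(\<integral>\<^sup>+s. ?A s \<partial>M) = (\<Sum>n. \<integral>\<^sup>+s. ennreal (1 - exp (- ((1 / 2 ^ n * s)\<^sup>2 / 2))) \<partial>M)"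
      by (rule nn_integral_suminf) measurable
    also have "\<dots> \<le> (\<Sum>n. ennreal (c * m2 * (1 / 2 powr p) ^ n))"
    proof (intro suminf_le summableI)
      fix n
      have "(\<integral>\<^sup>+s. ennreal (1 - exp (- ((1 / 2 ^ n * s)\<^sup>2 / 2))) \<partial>M)
          = ennreal (\<integral>s. 1 - exp (- ((1 / 2 ^ n * s)\<^sup>2 / 2)) \<partial>M)"
        using int1[of "1 / 2 ^ n"] by (intro nn_integral_eq_integral Bochner_Integration.integrable_diff) auto
      also have "\<dots> \<le> ennreal (c * m2 * (1 / 2 ^ n) powr p)"
        by (intro ennreal_leI small) simp
      also have "(1 / 2 ^ n) powr p = (1 / 2 powr p) ^ n"
        by (simp add: powr_divide power_divide powr_power powr_powr mult.commute flip: powr_realpow)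
      finally show "(\<integral>\<^sup>+s. ennreal (1 - exp (- ((1 / 2 ^ n * s)\<^sup>2 / 2))) \<partial>M) \<le> ennreal (c * m2 * (1 / 2 powr p) ^ n)" .
    qed
    also have "\<dots> < \<infinity>"
    proof -
      have "1 < 2 powr p" using p by (intro gr_one_powr) auto
      then show ?thesis using c m2
        by (subst suminf_ennreal2) (auto intro!: summable_mult summable_geometric)
    qed
    finally show ?thesis .
  qed
  have B: "(\<integral>\<^sup>+s. ?B s \<partial>M) < \<infinity>"
  proof -
    have "(\<integral>\<^sup>+s. ?B s \<partial>M) = (\<Sum>n. \<integral>\<^sup>+s. ennreal (exp (- ((2 ^ n * s)\<^sup>2 / 2))) \<partial>M)"
      by (rule nn_integral_suminf) measurable
    also have "\<dots> \<le> (\<Sum>n. ennreal (1 / 2 ^ n) * J)"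
      by (intro suminf_le summableI large) simp
    also have "\<dots> = (\<Sum>n. ennreal ((1 / 2) ^ n)) * J"
      by (simp add: power_divide)
    also have "(\<Sum>n. ennreal ((1 / 2) ^ n)) = ennreal (\<Sum>n. (1 / 2) ^ n)"
      by (subst suminf_ennreal2) (auto intro!: summable_geometric)
    also have "\<dots> * J < \<infinity>" using J by (simp add: ennreal_mult_less_top)
    finally show ?thesis .
  qed
  \<comment> \<open>At s = 0 every term of \<open>?B\<close> equals 1, so almost sure finiteness of
    \<open>?B\<close> excludes an atom at 0.\<close>
  have "AE s in M. ?B s \<noteq> \<infinity>"
    using B by (intro nn_integral_noteq_infinite) auto
  then show nz: "AE s in M. s \<noteq> 0"
  proof eventually_elim
    fix s assume fin: "?B s \<noteq> \<infinity>"
    show "s \<noteq> 0"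
    proof
      assume "s = 0"
      with fin have "summable (\<lambda>n::nat. 1 :: real)" by (intro summable_suminf_not_top) auto
      then show False by (auto dest: summable_LIMSEQ_zero simp: LIMSEQ_const_iff)
    qed
  qed
  define \<kappa> :: real where "\<kappa> = 1 - exp (- (1 / 2))"
  have \<kappa>: "0 < \<kappa>" by (simp add: \<kappa>_def)
  have "integrable M (\<lambda>s. \<kappa> * ln \<bar>s\<bar>)"
  proof (rule integrableI_bounded)
    have "(\<integral>\<^sup>+s. ennreal (norm (\<kappa> * ln \<bar>s\<bar>)) \<partial>M) \<le> (\<integral>\<^sup>+s. ?A s + ?B s \<partial>M)"
    proof (rule nn_integral_mono_AE)
      show "AE s in M. ennreal (norm (\<kappa> * ln \<bar>s\<bar>)) \<le> ?A s + ?B s"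
        using nz by eventually_elim (use \<kappa> abs_ln_le_dyadic_sums[OF _ \<kappa>_def] in \<open>simp add: abs_mult\<close>)
    qed
    also have "\<dots> = (\<integral>\<^sup>+s. ?A s \<partial>M) + (\<integral>\<^sup>+s. ?B s \<partial>M)" by (rule nn_integral_add) auto
    also have "\<dots> < \<infinity>" using A B by simp
    finally show "(\<integral>\<^sup>+s. ennreal (norm (\<kappa> * ln \<bar>s\<bar>)) \<partial>M) < \<infinity>" .
  qed simp
  then show "integrable M (\<lambda>s. ln \<bar>s\<bar>)" using \<kappa> by simp
qed

subsection \<open>Stable random vectors\<close>

text \<open>The Levy measure \<open>\<bar>r\<bar>\<^sup>-\<^sup>1\<^sup>-\<^sup>p dr\<close> of a symmetric stable law is, up to a factor, the image of
  Lebesgue measure under this map.\<close>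

definition levy_jump :: "real \<Rightarrow> real \<Rightarrow> real" where
  "levy_jump p \<tau> = sgn \<tau> * \<bar>\<tau>\<bar> powr (- 1 / p)"

lemma levy_jump_measurable [measurable]: "levy_jump p \<in> borel_measurable borel"
  unfolding levy_jump_def by measurable

lemma levy_jump_minus: "levy_jump p (- \<tau>) = - levy_jump p \<tau>"
  by (simp add: levy_jump_def sgn_minus)

lemma levy_jump_scale:
  assumes "0 < p" "0 < s"
  shows "levy_jump p (s powr p * \<tau>) = levy_jump p \<tau> / s"
  using assms by (simp add: levy_jump_def sgn_mult abs_mult powr_mult powr_powr powr_minus field_simps)

lemma levy_jump_sq_le:
  assumes p: "0 < p" and a: "0 < a" "a \<le> \<bar>\<tau>\<bar>"
  shows "(levy_jump p \<tau>)\<^sup>2 \<le> a powr (- 2 / p)"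
proof -
  have "\<tau> \<noteq> 0" using a by auto
  then have "(levy_jump p \<tau>)\<^sup>2 = \<bar>\<tau>\<bar> powr (- 2 / p)"
    by (simp add: levy_jump_def power_mult_distrib powr_power sgn_if)
  also have "\<dots> \<le> a powr (- 2 / p)"
    using p a by (intro powr_mono2') auto
  finally show ?thesis .
qed

text \<open>Shells in the parameter \<tau>, not in the jump size |\<tau>|^(-1/p): shell 0 holds the
  jumps larger than 1, and higher shells hold ever smaller jumps. Each shell has finite Lebesgue
  measure, as a Poisson rate must.\<close>

definition dyadic_shell :: "nat \<Rightarrow> real set" where
  "dyadic_shell = disjointed (\<lambda>k. {- (2 ^ k)<..<2 ^ k})"

lemma dyadic_shell_0: "dyadic_shell 0 = {-1<..<1}"
  by (simp add: dyadic_shell_def disjointed_0)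

lemma dyadic_shell_Suc: "dyadic_shell (Suc k) = {- (2 ^ Suc k)<..<2 ^ Suc k} - {- (2 ^ k)<..<2 ^ k}"
proof -
  have "mono (\<lambda>k. {- (2 ^ k)<..<2 ^ k :: real})"
  proof (rule monoI)
    fix i j :: nat assume "i \<le> j"
    then have "(2::real) ^ i \<le> 2 ^ j" by (simp add: power_increasing)
    then show "{- (2 ^ i)<..<2 ^ i :: real} \<subseteq> {- (2 ^ j)<..<2 ^ j}"
      by (intro subsetI) (simp only: greaterThanLessThan_iff, linarith)
  qed
  then show ?thesis unfolding dyadic_shell_def by (rule disjointed_mono)
qed

lemma dyadic_shell_sets [measurable]: "dyadic_shell k \<in> sets borel"
  by (cases k) (simp_all add: dyadic_shell_0 dyadic_shell_Suc)

lemma dyadic_shell_minus: "- \<tau> \<in> dyadic_shell k \<longleftrightarrow> \<tau> \<in> dyadic_shell k"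
  by (cases k) (auto simp: dyadic_shell_0 dyadic_shell_Suc)

lemma emeasure_dyadic_shell_0: "emeasure lborel (dyadic_shell 0) = 2"
  by (simp add: dyadic_shell_0)

lemma emeasure_dyadic_shell_Suc: "emeasure lborel (dyadic_shell (Suc k)) = ennreal (2 ^ Suc k)"
proof -
  have "emeasure lborel (dyadic_shell (Suc k))
      = emeasure lborel {- (2 ^ Suc k)<..<2 ^ Suc k :: real} - emeasure lborel {- (2 ^ k)<..<2 ^ k :: real}"
    unfolding dyadic_shell_Suc
    by (rule emeasure_Diff) auto
  also have "\<dots> = ennreal (2 ^ Suc k)"
    by (simp add: ennreal_minus)
  finally show ?thesis .
qed

lemma nn_integral_dyadic_shells:
  assumes [measurable]: "f \<in> borel_measurable borel"
  shows "(\<Sum>k. \<integral>\<^sup>+\<tau>\<in>dyadic_shell k. f \<tau> \<partial>lborel) = (\<integral>\<^sup>+\<tau>. f \<tau> \<partial>lborel)"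
proof -
  have "(\<Sum>k. \<integral>\<^sup>+\<tau>\<in>dyadic_shell k. f \<tau> \<partial>lborel) = (\<Sum>k. emeasure (density lborel f) (dyadic_shell k))"
    by (simp add: emeasure_density)
  also have "\<dots> = emeasure (density lborel f) (\<Union>k. dyadic_shell k)"
    by (rule suminf_emeasure) (auto simp: dyadic_shell_def[abs_def] disjoint_family_disjointed intro: dyadic_shell_sets[unfolded dyadic_shell_def])
  also have "(\<Union>k. dyadic_shell k) = UNIV"
  proof -
    have "\<exists>k. - (2 ^ k) < \<tau> \<and> \<tau> < 2 ^ k" for \<tau> :: real
      using real_arch_pow[of 2 "\<bar>\<tau>\<bar>"] by (auto simp: abs_less_iff minus_less_iff)
    then show ?thesis by (auto simp: dyadic_shell_def UN_disjointed_eq)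
  qed
  finally show ?thesis by (simp add: emeasure_density)
qed

text \<open>The part of the Levy-Khintchine exponent due to the jumps of one shell. Only the cosine
  appears because the shell and the jump map are symmetric under \<tau> to -\<tau>.\<close>

definition shell_exponent :: "real \<Rightarrow> nat \<Rightarrow> real \<Rightarrow> ennreal" where
  "shell_exponent p k s = (\<integral>\<^sup>+\<tau>\<in>dyadic_shell k. ennreal (1 - cos (levy_jump p \<tau> * s)) \<partial>lborel)"

lemma shell_exponent_measurable [measurable]: "shell_exponent p k \<in> borel_measurable borel"
  unfolding shell_exponent_def by measurable

lemma shell_exponent_0_le: "shell_exponent p 0 s \<le> 4"
proof -
  have "shell_exponent p 0 s \<le> (\<integral>\<^sup>+\<tau>. 2 * indicator (dyadic_shell 0) \<tau> \<partial>lborel)"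
    unfolding shell_exponent_def
  proof (intro nn_integral_mono mult_right_mono)
    fix \<tau>
    have "1 - cos (levy_jump p \<tau> * s) \<le> 2" using cos_ge_minus_one[of "levy_jump p \<tau> * s"] by linarith
    then have "ennreal (1 - cos (levy_jump p \<tau> * s)) \<le> ennreal 2" by (rule ennreal_leI)
    then show "ennreal (1 - cos (levy_jump p \<tau> * s)) \<le> 2" by simp
  qed simp
  also have "\<dots> = 4" by (subst nn_integral_cmult_indicator) (simp_all add: emeasure_dyadic_shell_0)
  finally show ?thesis .
qed

text \<open>The shell has mass 2^(k+1), its squared jumps are at most 2^(-2k/p), and 1 - cos u \<le>
  u^2 / 2. The product is a multiple of 2^(k(1 - 2/p)), which decays in k exactly when p <
  2.\<close>

lemma shell_exponent_Suc_le:
  assumes p: "0 < p"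
  shows "shell_exponent p (Suc k) s \<le> ennreal (((2 powr (1 / 2 - 1 / p)) ^ k)\<^sup>2 * s\<^sup>2)"
proof -
  define D where "D = (2 ^ k) powr (- 2 / p) * s\<^sup>2 / 2"
  have "shell_exponent p (Suc k) s \<le> (\<integral>\<^sup>+\<tau>. ennreal D * indicator (dyadic_shell (Suc k)) \<tau> \<partial>lborel)"
    unfolding shell_exponent_def
  proof (intro nn_integral_mono)
    fix \<tau> :: real
    have "1 - cos (levy_jump p \<tau> * s) \<le> D" if "\<tau> \<in> dyadic_shell (Suc k)"
    proof -
      have "2 ^ k \<le> \<bar>\<tau>\<bar>" using that by (auto simp: dyadic_shell_Suc)
      then have "(levy_jump p \<tau>)\<^sup>2 \<le> (2 ^ k) powr (- 2 / p)"
        using p by (intro levy_jump_sq_le) auto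
      then have "(levy_jump p \<tau> * s)\<^sup>2 / 2 \<le> D"
        by (simp add: D_def power_mult_distrib mult_right_mono)
      then show ?thesis using one_minus_cos_le[of "levy_jump p \<tau> * s"] by linarith
    qed
    then show "ennreal (1 - cos (levy_jump p \<tau> * s)) * indicator (dyadic_shell (Suc k)) \<tau>
        \<le> ennreal D * indicator (dyadic_shell (Suc k)) \<tau>"
      by (auto simp: indicator_def intro: ennreal_leI)
  qed
  also have "\<dots> = ennreal (D * 2 ^ Suc k)"
    by (subst nn_integral_cmult_indicator)
       (simp_all add: emeasure_dyadic_shell_Suc ennreal_mult'' del: power_Suc)
  also have "D * 2 ^ Suc k = ((2 powr (1 / 2 - 1 / p)) ^ k)\<^sup>2 * s\<^sup>2"
  proof -
    have pk: "2 ^ k = (2::real) powr real k" by (simp add: powr_realpow)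
    have "(2 ^ k) powr (- 2 / p) * 2 ^ k = (2::real) powr (real k * (- 2 / p) + real k)"
      unfolding pk powr_powr powr_add by (rule refl)
    also have "real k * (- 2 / p) + real k = (1 / 2 - 1 / p) * real k * 2"
      by (simp add: field_simps)
    also have "2 powr \<dots> = ((2 powr (1 / 2 - 1 / p)) ^ k)\<^sup>2"
      by (simp add: powr_power mult_ac)
    finally show ?thesis by (simp add: D_def)
  qed
  finally show ?thesis .
qed

definition levy_constant :: "real \<Rightarrow> ennreal" where
  "levy_constant p = (\<integral>\<^sup>+\<tau>. ennreal (1 - cos (levy_jump p \<tau>)) \<partial>lborel)"

text \<open>The shells add up to the integral over the whole line, where the substitution of |s|^p
  \<tau> for \<tau> divides each jump by |s| and brings out the factor |s|^p; the sign of s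
  disappears since cos is even. In \<open>ennreal\<close> this precedes any finiteness of the
  constant.\<close>

lemma suminf_shell_exponent:
  assumes p: "0 < p"
  shows "(\<Sum>k. shell_exponent p k s) = ennreal (\<bar>s\<bar> powr p) * levy_constant p"
proof -
  have sum: "(\<Sum>k. shell_exponent p k s) = (\<integral>\<^sup>+\<tau>. ennreal (1 - cos (levy_jump p \<tau> * s)) \<partial>lborel)"
    unfolding shell_exponent_def by (rule nn_integral_dyadic_shells) simp
  show ?thesis
  proof (cases "s = 0")
    case True then show ?thesis using sum by simp
  next
    case False
    have "(\<integral>\<^sup>+\<tau>. ennreal (1 - cos (levy_jump p \<tau> * s)) \<partial>lborel)
        = ennreal (\<bar>s\<bar> powr p) * (\<integral>\<^sup>+\<tau>. ennreal (1 - cos (levy_jump p (\<bar>s\<bar> powr p * \<tau>) * s)) \<partial>lborel)"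
      using False by (subst nn_integral_real_affine[where c="\<bar>s\<bar> powr p" and t=0]) auto
    also have "(\<lambda>\<tau>. cos (levy_jump p (\<bar>s\<bar> powr p * \<tau>) * s)) = (\<lambda>\<tau>. cos (levy_jump p \<tau>))"
      using False p by (cases "0 < s") (auto simp: levy_jump_scale fun_eq_iff)
    finally show ?thesis unfolding sum levy_constant_def by (simp add: fun_eq_iff)
  qed
qed

lemma levy_constant_finite:
  assumes p: "0 < p" "p < 2"
  shows "levy_constant p < \<infinity>"
proof -
  define \<sigma> where "\<sigma> = 2 powr (1 / 2 - 1 / p)"
  have \<sigma>: "0 < \<sigma>" "\<sigma> < 1" using p by (auto simp: \<sigma>_def powr_less_one field_simps)
  then have \<sigma>2: "\<sigma>\<^sup>2 < 1" by (simp add: power2_less_1_iff)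
  define b where "b k = (case k of 0 \<Rightarrow> 4 | Suc k \<Rightarrow> (\<sigma>\<^sup>2) ^ k)" for k
  have "levy_constant p = (\<Sum>k. shell_exponent p k 1)"
    using suminf_shell_exponent[OF p(1), of 1] by simp
  also have "\<dots> \<le> (\<Sum>k. ennreal (b k))"
  proof (intro suminf_le summableI)
    fix k show "shell_exponent p k 1 \<le> ennreal (b k)"
      using shell_exponent_0_le[of p 1] shell_exponent_Suc_le[OF p(1), of _ 1]
      by (cases k) (auto simp: b_def \<sigma>_def power_mult[symmetric] mult.commute)
  qed
  also have "\<dots> < \<infinity>"
  proof -
    have "summable (\<lambda>k. b (Suc k))" using \<sigma> \<sigma>2 by (auto simp: b_def intro!: summable_geometric)
    then have "summable b" by (simp only: summable_Suc_iff)
    moreover have "0 \<le> b k" for k by (cases k) (auto simp: b_def)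
    ultimately show ?thesis by (subst suminf_ennreal2) auto
  qed
  finally show ?thesis .
qed

lemma levy_constant_pos:
  assumes p: "0 < p"
  shows "0 < levy_constant p"
proof -
  \<comment> \<open>For 1 \<le> \<tau> \<le> 2 the jump lies between \<open>a\<close> and 1, where
    cos decreases, so the integrand is at least 1 - cos a there.\<close>
  define a where "a = 2 powr (- 1 / p)"
  have a: "0 < a" "a \<le> 1" using p powr_mono[of "- 1 / p" 0 2] by (auto simp: a_def)
  have "cos a < cos 0" using a pi_gt3 by (intro cos_monotone_0_pi) auto
  then have "0 < ennreal (1 - cos a) * emeasure lborel {1..2::real}" by simp
  also have "\<dots> = (\<integral>\<^sup>+\<tau>. ennreal (1 - cos a) * indicator {1..2::real} \<tau> \<partial>lborel)"
    by (subst nn_integral_cmult_indicator) auto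
  also have "\<dots> \<le> levy_constant p"
    unfolding levy_constant_def
  proof (rule nn_integral_mono)
    fix \<tau> :: real
    have "cos (levy_jump p \<tau>) \<le> cos a" if "\<tau> \<in> {1..2}"
    proof (rule cos_monotone_0_pi_le)
      have j: "levy_jump p \<tau> = \<tau> powr (- 1 / p)" using that by (simp add: levy_jump_def)
      show "a \<le> levy_jump p \<tau>" unfolding j a_def using that p by (intro powr_mono2') auto
      have "levy_jump p \<tau> \<le> 1 powr (- 1 / p)" unfolding j using that p by (intro powr_mono2') auto
      then show "levy_jump p \<tau> \<le> pi" using pi_gt3 by simp
    qed (use a in auto)
    then show "ennreal (1 - cos a) * indicator {1..2::real} \<tau> \<le> ennreal (1 - cos (levy_jump p \<tau>))"
      by (auto simp: indicator_def intro: ennreal_leI)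
  qed
  finally show ?thesis .
qed

text \<open>Compound Poisson with jumps \<open>levy_jump p \<tau> *\<^sub>R \<xi>\<close>, where
  \<tau> is uniform on the shell and \<xi> has law \<open>M\<close>. The rate r is the mass of the
  shell, which cancels the normalisation of the uniform law.\<close>

lemma shell_law_exists:
  fixes M :: "'a::euclidean_space measure"
  assumes M: "prob_space M" and sets[measurable_cong]: "sets M = sets borel"
  shows "\<exists>P h. prob_space P \<and> sets P = sets borel \<and>
    (\<forall>x. cf P x = of_real (exp (- h x)) \<and> 0 \<le> h x \<and>
         ennreal (h x) = (\<integral>\<^sup>+\<xi>. shell_exponent p k (x \<bullet> \<xi>) \<partial>M))"
proof -
  interpret M: prob_space M by fact
  let ?A = "dyadic_shell k"
  define r :: real where "r = (case k of 0 \<Rightarrow> 2 | Suc j \<Rightarrow> 2 ^ Suc j)"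
  have r: "0 < r" by (cases k) (auto simp: r_def)
  have em: "emeasure lborel ?A = ennreal r"
    by (cases k) (auto simp: r_def emeasure_dyadic_shell_0 emeasure_dyadic_shell_Suc simp del: power_Suc)
  define U where "U = uniform_measure lborel ?A"
  interpret U: prob_space U
    unfolding U_def using r em by (intro prob_space_uniform_measure) auto
  have [measurable_cong]: "sets U = sets borel" by (simp add: U_def)
  interpret UM: pair_prob_space U M ..
  define S where "S = (\<lambda>(\<tau>, \<xi>::'a). levy_jump p \<tau> *\<^sub>R \<xi>)"
  have [measurable]: "S \<in> borel_measurable (U \<Otimes>\<^sub>M M)" unfolding S_def by measurable
  define N where "N = distr (U \<Otimes>\<^sub>M M) borel S"
  have N: "prob_space N" unfolding N_def by (rule UM.prob_space_distr) simp
  interpret N: prob_space N by (rule N)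
  have sN[measurable_cong]: "sets N = sets borel" by (simp add: N_def)
  \<comment> \<open>The random sign of \<tau> symmetrises the jumps for each fixed direction
    \<xi>.\<close>
  have odd: "(\<integral>\<tau>. sin (levy_jump p \<tau> * s) \<partial>U) = 0" for s
  proof -
    let ?f = "\<lambda>\<tau>. (indicator ?A \<tau> / r) * sin (levy_jump p \<tau> * s)"
    have "1 / ennreal r = ennreal (1 / r)" using r divide_ennreal[of 1 r] by simp
    then have "U = density lborel (\<lambda>\<tau>. ennreal (indicator ?A \<tau> / r))"
      unfolding U_def uniform_measure_def em
      by (intro density_cong) (auto simp: indicator_def)
    then have "(\<integral>\<tau>. sin (levy_jump p \<tau> * s) \<partial>U) = (\<integral>\<tau>. ?f \<tau> \<partial>lborel)"
      using r by (simp add: integral_density)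
    moreover have "(\<integral>\<tau>. ?f \<tau> \<partial>lborel) = (\<integral>\<tau>. ?f (- \<tau>) \<partial>lborel)"
      by (subst lborel_integral_real_affine[where c="-1" and t=0]) auto
    moreover have "(\<integral>\<tau>. ?f (- \<tau>) \<partial>lborel) = - (\<integral>\<tau>. ?f \<tau> \<partial>lborel)"
      unfolding Bochner_Integration.integral_minus[symmetric]
      by (rule Bochner_Integration.integral_cong)
         (simp_all add: levy_jump_minus dyadic_shell_minus indicator_def)
    ultimately show ?thesis by linarith
  qed
  have sym: "(\<integral>y. sin (x \<bullet> y) \<partial>N) = 0" for x
  proof -
    have "(\<integral>y. sin (x \<bullet> y) \<partial>N) = (\<integral>w. sin (x \<bullet> S w) \<partial>(U \<Otimes>\<^sub>M M))"
      unfolding N_def by (rule integral_distr) auto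
    also have "(\<lambda>w. sin (x \<bullet> S w)) = (\<lambda>(\<tau>, \<xi>). sin (x \<bullet> S (\<tau>, \<xi>)))"
      by auto
    also have "integral\<^sup>L (U \<Otimes>\<^sub>M M) \<dots> = (\<integral>\<xi>. \<integral>\<tau>. sin (x \<bullet> S (\<tau>, \<xi>)) \<partial>U \<partial>M)"
      by (rule UM.integral_snd[symmetric])
         (auto intro!: UM.P.integrable_const_bound[where B=1] simp: split_beta)
    also have "\<dots> = 0" by (simp add: S_def odd)
    finally show ?thesis .
  qed
  define h where "h x = r * (\<integral>y. (1 - cos (x \<bullet> y)) \<partial>N)" for x
  obtain P where P: "prob_space P" "sets P = sets borel"
      "\<And>x. cf P x = of_real (exp (- r * (\<integral>y. (1 - cos (x \<bullet> y)) \<partial>N)))"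
    using compound_poisson_exists[OF N sN r sym] by blast
  have "ennreal (h x) = (\<integral>\<^sup>+\<xi>. shell_exponent p k (x \<bullet> \<xi>) \<partial>M)" for x
  proof -
    have "ennreal (h x) = ennreal r * ennreal (\<integral>y. (1 - cos (x \<bullet> y)) \<partial>N)"
      unfolding h_def using r by (simp add: ennreal_mult')
    also have "ennreal (\<integral>y. (1 - cos (x \<bullet> y)) \<partial>N) = (\<integral>\<^sup>+y. ennreal (1 - cos (x \<bullet> y)) \<partial>N)"
    proof (rule nn_integral_eq_integral[symmetric])
      show "integrable N (\<lambda>y. 1 - cos (x \<bullet> y))"
        by (intro Bochner_Integration.integrable_diff N.integrable_const_bound[where B=1]) auto
    qed simp
    also have "\<dots> = (\<integral>\<^sup>+w. ennreal (1 - cos (x \<bullet> S w)) \<partial>(U \<Otimes>\<^sub>M M))"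
      unfolding N_def by (rule nn_integral_distr) auto
    also have "\<dots> = (\<integral>\<^sup>+\<xi>. \<integral>\<^sup>+\<tau>. ennreal (1 - cos (x \<bullet> S (\<tau>, \<xi>))) \<partial>U \<partial>M)"
      by (rule UM.nn_integral_snd[symmetric]) simp
    also have "\<dots> = (\<integral>\<^sup>+\<xi>. shell_exponent p k (x \<bullet> \<xi>) / ennreal r \<partial>M)"
      unfolding U_def by (simp add: nn_integral_uniform_measure S_def shell_exponent_def em)
    also have "\<dots> = (\<integral>\<^sup>+\<xi>. shell_exponent p k (x \<bullet> \<xi>) \<partial>M) / ennreal r"
      by (rule nn_integral_divide) measurable
    also have "ennreal r * \<dots> = (\<integral>\<^sup>+\<xi>. shell_exponent p k (x \<bullet> \<xi>) \<partial>M)"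
      unfolding ennreal_times_divide mult.commute[of "ennreal r"]
      by (rule ennreal_mult_divide_eq) (use r in auto)
    finally show ?thesis .
  qed
  moreover have "0 \<le> h x" for x
    unfolding h_def using r by (intro mult_nonneg_nonneg Bochner_Integration.integral_nonneg) auto
  ultimately show ?thesis
    using P by (intro exI[of _ P] exI[of _ h]) (auto simp: h_def)
qed

text \<open>One compound Poisson vector is taken per shell. All exponents are nonnegative, so their
  sum may be taken inside the integral over \<open>M\<close>, where it is c |(x, \<xi>)|^p with c
  the Levy constant. The bound on the norm of \<xi> turns the shell estimates into multiples of
  |x|^2, as the convergence of the series requires.\<close>

lemma stable_law_exists:
  fixes M :: "'a::euclidean_space measure"
  assumes M: "prob_space M" and sets[measurable_cong]: "sets M = sets borel"
    and bd: "AE \<xi> in M. norm \<xi> \<le> 1" and p: "0 < p" "p < 2"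
  shows "\<exists>Q c. prob_space Q \<and> sets Q = sets borel \<and> 0 < c \<and>
      (\<forall>x. cf Q x = of_real (exp (- (c * (\<integral>\<xi>. \<bar>x \<bullet> \<xi>\<bar> powr p \<partial>M)))))"
proof -
  interpret M: prob_space M by fact
  have "\<forall>k. \<exists>P h. prob_space P \<and> sets P = sets borel \<and>
    (\<forall>x. cf P x = of_real (exp (- h x)) \<and> 0 \<le> h x \<and>
         ennreal (h x) = (\<integral>\<^sup>+\<xi>. shell_exponent p k (x \<bullet> \<xi>) \<partial>M))"
    using shell_law_exists[OF M sets] by blast
  then obtain P h where P: "\<And>k. prob_space (P k)" "\<And>k. sets (P k) = sets borel"
      "\<And>k x. cf (P k) x = of_real (exp (- h k x))"
    and h0: "\<And>k x. 0 \<le> h k x"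
    and h: "\<And>k x. ennreal (h k x) = (\<integral>\<^sup>+\<xi>. shell_exponent p k (x \<bullet> \<xi>) \<partial>M)"
    by metis
  define c where "c = enn2real (levy_constant p)"
  have lc: "levy_constant p = ennreal c"
    using levy_constant_finite[OF p] by (simp add: c_def)
  have c: "0 < c" using levy_constant_pos[OF p(1)] unfolding lc by simp
  define \<sigma> where "\<sigma> = 2 powr (1 / 2 - 1 / p)"
  have \<sigma>: "0 < \<sigma>" "\<sigma> < 1" using p by (auto simp: \<sigma>_def powr_less_one field_simps)
  have int: "integrable M (\<lambda>\<xi>. \<bar>x \<bullet> \<xi>\<bar> powr p)" for x
  proof (rule M.integrable_const_bound[where B="norm x powr p"])
    show "AE \<xi> in M. norm (\<bar>x \<bullet> \<xi>\<bar> powr p) \<le> norm x powr p"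
      using bd
    proof eventually_elim
      fix \<xi> :: 'a assume "norm \<xi> \<le> 1"
      then have "\<bar>x \<bullet> \<xi>\<bar> \<le> norm x"
        using Cauchy_Schwarz_ineq2[of x \<xi>] mult_left_le[of "norm \<xi>" "norm x"] by simp
      then show "norm (\<bar>x \<bullet> \<xi>\<bar> powr p) \<le> norm x powr p" using p by (simp add: powr_mono2)
    qed
  qed simp
  have "\<exists>Q. prob_space Q \<and> sets Q = sets borel \<and>
      (\<forall>x. cf Q x = of_real (exp (- (c * (\<integral>\<xi>. \<bar>x \<bullet> \<xi>\<bar> powr p \<partial>M)))))"
  proof (rule sum_of_independent_exists[OF P _ \<sigma>])
    fix k x
    have "ennreal (h (Suc k) x) \<le> (\<integral>\<^sup>+\<xi>. ennreal ((\<sigma> ^ k)\<^sup>2 * (norm x)\<^sup>2) \<partial>M)"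
      unfolding h
    proof (rule nn_integral_mono_AE)
      show "AE \<xi> in M. shell_exponent p (Suc k) (x \<bullet> \<xi>) \<le> ennreal ((\<sigma> ^ k)\<^sup>2 * (norm x)\<^sup>2)"
        using bd
      proof eventually_elim
        fix \<xi> :: 'a assume "norm \<xi> \<le> 1"
        then have "\<bar>x \<bullet> \<xi>\<bar> \<le> norm x"
          using Cauchy_Schwarz_ineq2[of x \<xi>] mult_left_le[of "norm \<xi>" "norm x"] by simp
        then have "(x \<bullet> \<xi>)\<^sup>2 \<le> (norm x)\<^sup>2" by (simp add: abs_le_square_iff[symmetric])
        then have "ennreal ((\<sigma> ^ k)\<^sup>2 * (x \<bullet> \<xi>)\<^sup>2) \<le> ennreal ((\<sigma> ^ k)\<^sup>2 * (norm x)\<^sup>2)"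
          by (intro ennreal_leI mult_left_mono) auto
        with shell_exponent_Suc_le[OF p(1), of k "x \<bullet> \<xi>"]
        show "shell_exponent p (Suc k) (x \<bullet> \<xi>) \<le> ennreal ((\<sigma> ^ k)\<^sup>2 * (norm x)\<^sup>2)"
          unfolding \<sigma>_def by (rule order_trans)
      qed
    qed
    then show "h (Suc k) x \<le> (\<sigma> ^ k)\<^sup>2 * (norm x)\<^sup>2"
      by (simp add: M.emeasure_space_1)
  next
    fix x
    have "(\<Sum>k. ennreal (h k x)) = (\<integral>\<^sup>+\<xi>. (\<Sum>k. shell_exponent p k (x \<bullet> \<xi>)) \<partial>M)"
      unfolding h by (rule nn_integral_suminf[symmetric]) measurable
    also have "\<dots> = (\<integral>\<^sup>+\<xi>. ennreal (\<bar>x \<bullet> \<xi>\<bar> powr p) \<partial>M) * ennreal c"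
      by (simp add: suminf_shell_exponent[OF p(1)] lc nn_integral_multc)
    also have "\<dots> = ennreal (c * (\<integral>\<xi>. \<bar>x \<bullet> \<xi>\<bar> powr p \<partial>M))"
      using c int[of x] by (simp add: nn_integral_eq_integral ennreal_mult' mult.commute)
    finally have eq: "(\<Sum>k. ennreal (h k x)) = ennreal (c * (\<integral>\<xi>. \<bar>x \<bullet> \<xi>\<bar> powr p \<partial>M))" .
    then have s: "summable (\<lambda>k. h k x)" using h0 by (intro summable_suminf_not_top) auto
    then have "ennreal (\<Sum>k. h k x) = ennreal (c * (\<integral>\<xi>. \<bar>x \<bullet> \<xi>\<bar> powr p \<partial>M))"
      using eq h0 by (subst suminf_ennreal2[symmetric]) auto
    then have "(\<Sum>k. h k x) = c * (\<integral>\<xi>. \<bar>x \<bullet> \<xi>\<bar> powr p \<partial>M)"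
      using c h0 s by (subst (asm) ennreal_inj) (auto intro!: suminf_nonneg mult_nonneg_nonneg)
    with s show "(\<lambda>k. h k x) sums (c * (\<integral>\<xi>. \<bar>x \<bullet> \<xi>\<bar> powr p \<partial>M))"
      using summable_sums by fastforce
  qed
  with c show ?thesis by blast
qed

subsection \<open>Embedding into \<open>L\<^sub>0\<close>\<close>

text \<open>At p = 2 the ratio 2^(1/2 - 1/p) of the shell bounds becomes 1. The exponent is then the
  second moment form of \<open>M\<close>, and the Gaussian normalisation gives c = 1/2.\<close>

lemma levy_law_exists:
  fixes M :: "'a::euclidean_space measure"
  assumes M: "prob_space M" and sets[measurable_cong]: "sets M = sets borel"
    and bd: "AE \<xi> in M. norm \<xi> \<le> 1" and p: "0 < p" "p \<le> 2"
  shows "\<exists>Q c. prob_space Q \<and> sets Q = sets borel \<and> 0 < c \<and>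
      (\<forall>x. cf Q x = of_real (exp (- (c * (\<integral>\<xi>. \<bar>x \<bullet> \<xi>\<bar> powr p \<partial>M)))))"
proof (cases "p < 2")
  case True
  then show ?thesis using stable_law_exists[OF M sets bd] p by blast
next
  case False
  then have [simp]: "p = 2" using p by simp
  interpret M: prob_space M by fact
  define f where "f x y = (\<integral>\<xi>. (x \<bullet> \<xi>) * (y \<bullet> \<xi>) \<partial>M)" for x y
  have int: "integrable M (\<lambda>\<xi>. (x \<bullet> \<xi>) * (y \<bullet> \<xi>))" for x y
  proof (rule M.integrable_const_bound[where B="norm x * norm y"])
    show "AE \<xi> in M. norm ((x \<bullet> \<xi>) * (y \<bullet> \<xi>)) \<le> norm x * norm y"
      using bd
    proof eventually_elim
      fix \<xi> :: 'a assume "norm \<xi> \<le> 1"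
      then have "\<bar>z \<bullet> \<xi>\<bar> \<le> norm z" for z
        using Cauchy_Schwarz_ineq2[of z \<xi>] mult_left_le[of "norm \<xi>" "norm z"] by simp
      then show "norm ((x \<bullet> \<xi>) * (y \<bullet> \<xi>)) \<le> norm x * norm y"
        by (simp add: abs_mult mult_mono)
    qed
  qed simp
  have "bilinear_psd f"
    unfolding bilinear_psd_def
  proof (intro conjI allI)
    fix y show "linear (\<lambda>x. f x y)"
      unfolding f_def using int
      by (intro linearI) (simp_all add: inner_add_left distrib_right mult.assoc)
  qed (auto simp: f_def mult.commute)
  then obtain Q where Q: "prob_space Q" "sets Q = sets borel" "\<And>x. cf Q x = of_real (exp (- (f x x / 2)))"
    using gaussian_exists by blast
  have "f x x / 2 = 1 / 2 * (\<integral>\<xi>. \<bar>x \<bullet> \<xi>\<bar> powr p \<partial>M)" for x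
  proof -
    have "\<bar>x \<bullet> \<xi>\<bar> powr p = (x \<bullet> \<xi>) * (x \<bullet> \<xi>)" for \<xi>
      by (simp add: power2_eq_square)
    then show ?thesis by (simp add: f_def)
  qed
  with Q show ?thesis by (intro exI[of _ Q] exI[of _ "1/2"]) auto
qed

lemma log_moments_of_law:
  fixes Q :: "'a::euclidean_space measure" and N :: "'a \<Rightarrow> real"
  assumes Q: "prob_space Q" and sets[measurable_cong]: "sets Q = sets borel"
    and cf: "\<And>x. cf Q x = of_real (exp (- (c * N x powr p)))"
    and c: "0 < c" and p: "0 < p" "p \<le> 2"
    and N: "\<And>x. x \<noteq> 0 \<Longrightarrow> 0 < N x" "\<And>t x. N (t *\<^sub>R x) = \<bar>t\<bar> * N x"
  obtains \<kappa> where "\<And>x. x \<noteq> 0 \<Longrightarrow> AE z in Q. x \<bullet> z \<noteq> 0"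
    and "\<And>x. x \<noteq> 0 \<Longrightarrow> integrable Q (\<lambda>z. ln \<bar>x \<bullet> z\<bar>)"
    and "\<And>x. x \<noteq> 0 \<Longrightarrow> (\<integral>z. ln \<bar>x \<bullet> z\<bar> \<partial>Q) = ln (N x) + \<kappa>"
proof -
  interpret Q: prob_space Q by fact
  define D where "D x = distr Q borel (\<lambda>z. ((1 / N x) *\<^sub>R x) \<bullet> z)" for x
  have D: "real_distribution (D x)" for x
    unfolding D_def real_distribution_def real_distribution_axioms_def
    by (auto intro!: Q.prob_space_distr)
  have char: "char (D x) t = of_real (exp (- (c * \<bar>t\<bar> powr p)))" if "x \<noteq> 0" for x t
  proof -
    have "char (D x) t = cf Q (t *\<^sub>R (1 / N x) *\<^sub>R x)"
      unfolding D_def by (rule char_distr_inner[OF sets])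
    moreover have "N (t *\<^sub>R (1 / N x) *\<^sub>R x) = \<bar>t\<bar>" using N(1)[OF that] by (simp add: N(2))
    ultimately show ?thesis by (simp only: cf)
  qed
  have AE: "AE z in Q. x \<bullet> z \<noteq> 0" and int: "integrable Q (\<lambda>z. ln \<bar>x \<bullet> z\<bar> - ln (N x))"
    and eq: "(\<integral>s. ln \<bar>s\<bar> \<partial>D x) = (\<integral>z. ln \<bar>x \<bullet> z\<bar> - ln (N x) \<partial>Q)" if x: "x \<noteq> 0" for x
  proof -
    interpret D: real_distribution "D x" by (rule D)
    note ln = D.ln_abs_integrable[OF c p char[OF x]]
    have "AE z in Q. ((1 / N x) *\<^sub>R x) \<bullet> z \<noteq> 0"
      using ln(1) unfolding D_def by (subst (asm) AE_distr_iff) auto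
    then show nz: "AE z in Q. x \<bullet> z \<noteq> 0" by eventually_elim auto
    have ae: "AE z in Q. ln \<bar>((1 / N x) *\<^sub>R x) \<bullet> z\<bar> = ln \<bar>x \<bullet> z\<bar> - ln (N x)"
      using nz by eventually_elim (use N(1)[OF x] in \<open>simp add: abs_mult ln_div\<close>)
    have "integrable Q (\<lambda>z. ln \<bar>((1 / N x) *\<^sub>R x) \<bullet> z\<bar>)"
      using ln(2) unfolding D_def by (subst (asm) integrable_distr_eq) auto
    then show "integrable Q (\<lambda>z. ln \<bar>x \<bullet> z\<bar> - ln (N x))"
      using ae by (subst (asm) integrable_cong_AE) auto
    show "(\<integral>s. ln \<bar>s\<bar> \<partial>D x) = (\<integral>z. ln \<bar>x \<bullet> z\<bar> - ln (N x) \<partial>Q)"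
      unfolding D_def using ae by (subst integral_distr) (auto intro!: integral_cong_AE)
  qed
  have int': "integrable Q (\<lambda>z. ln \<bar>x \<bullet> z\<bar>)" if "x \<noteq> 0" for x
    using Bochner_Integration.integrable_add[OF int[OF that], of "\<lambda>_. ln (N x)"] by simp
  \<comment> \<open>Any nonzero vector serves as reference: homogeneity of \<open>N\<close> makes
    the characteristic function of \<open>D x\<close> independent of x, so \<kappa> may be read off
    from \<open>D b\<close>.\<close>
  obtain b :: 'a where b: "b \<noteq> 0" using SOME_Basis nonzero_Basis by blast
  show ?thesis
  proof (rule that[of "\<integral>s. ln \<bar>s\<bar> \<partial>D b"])
    fix x :: 'a assume x: "x \<noteq> 0"
    show "AE z in Q. x \<bullet> z \<noteq> 0" by (rule AE[OF x])
    show "integrable Q (\<lambda>z. ln \<bar>x \<bullet> z\<bar>)" by (rule int'[OF x])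
    have "D x = D b" using char[OF x] char[OF b] by (intro Levy_uniqueness D ext) simp
    then have "(\<integral>s. ln \<bar>s\<bar> \<partial>D b) = (\<integral>z. ln \<bar>x \<bullet> z\<bar> - ln (N x) \<partial>Q)"
      using eq[OF x] by simp
    also have "\<dots> = (\<integral>z. ln \<bar>x \<bullet> z\<bar> \<partial>Q) - ln (N x)"
      using int'[OF x] by (simp add: Q.prob_space)
    finally show "(\<integral>z. ln \<bar>x \<bullet> z\<bar> \<partial>Q) = ln (N x) + (\<integral>s. ln \<bar>s\<bar> \<partial>D b)" by simp
  qed
qed

text \<open>Squeezes \<open>norm z\<close> between one coordinate and the sum of all coordinates.\<close>

lemma ln_norm_integrable:
  fixes Q :: "'a::euclidean_space measure"
  assumes sets[measurable_cong]: "sets Q = sets borel"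
    and nz: "\<And>b. b \<in> Basis \<Longrightarrow> AE z in Q. b \<bullet> z \<noteq> 0"
    and int: "\<And>b. b \<in> Basis \<Longrightarrow> integrable Q (\<lambda>z. ln \<bar>b \<bullet> z\<bar>)"
    and Q: "prob_space Q"
  shows "AE z in Q. z \<noteq> 0" "integrable Q (\<lambda>z. ln (norm z))"
proof -
  interpret Q: prob_space Q by fact
  have all: "AE z in Q. \<forall>b\<in>Basis. b \<bullet> z \<noteq> 0"
    using nz by (intro AE_finite_allI) auto
  then show "AE z in Q. z \<noteq> 0"
    by eventually_elim (use SOME_Basis in force)
  define S where "S z = (\<Sum>b\<in>Basis. \<bar>ln \<bar>b \<bullet> z\<bar>\<bar>)" for z :: 'a
  show "integrable Q (\<lambda>z. ln (norm z))"
  proof (rule Bochner_Integration.integrable_bound)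
    show "integrable Q (\<lambda>z. ln (DIM('a)) + S z)"
      unfolding S_def using int by (intro Bochner_Integration.integrable_add Bochner_Integration.integrable_sum integrable_abs) auto
    show "AE z in Q. norm (ln (norm z)) \<le> norm (ln (DIM('a)) + S z)"
      using all
    proof eventually_elim
      fix z :: 'a assume z: "\<forall>b\<in>Basis. b \<bullet> z \<noteq> 0"
      define i :: 'a where "i = (SOME b. b \<in> Basis)"
      have i: "i \<in> Basis" unfolding i_def by (rule SOME_Basis)
      have zpos: "0 < norm z" using z i by auto
      have S: "\<bar>ln \<bar>b \<bullet> z\<bar>\<bar> \<le> S z" if "b \<in> Basis" for b
        unfolding S_def using that by (intro member_le_sum) auto
      have S0: "0 \<le> S z" unfolding S_def by (intro sum_nonneg) auto
      have d: "0 \<le> ln (real (DIM('a)))" using DIM_positive[where 'a='a] by (intro ln_ge_zero) linarith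
      have "ln \<bar>i \<bullet> z\<bar> \<le> ln (norm z)"
        using Basis_le_norm[OF i, of z] z i zpos by (subst ln_le_cancel_iff) (auto simp: inner_commute)
      then have lower: "- S z \<le> ln (norm z)" using S[OF i] by linarith
      have "norm z \<le> (\<Sum>b\<in>Basis. \<bar>b \<bullet> z\<bar>)"
        using norm_le_l1[of z] by (simp add: inner_commute)
      also have "\<dots> \<le> (\<Sum>b\<in>(Basis::'a set). exp (S z))"
      proof (rule sum_mono)
        fix b :: 'a assume b: "b \<in> Basis"
        have "\<bar>b \<bullet> z\<bar> = exp (ln \<bar>b \<bullet> z\<bar>)" using z b by simp
        also have "\<dots> \<le> exp (S z)" using S[OF b] by (simp only: exp_le_cancel_iff)
        finally show "\<bar>b \<bullet> z\<bar> \<le> exp (S z)" .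
      qed
      finally have "norm z \<le> DIM('a) * exp (S z)" by simp
      then have "ln (norm z) \<le> ln (DIM('a) * exp (S z))" using zpos by (subst ln_le_cancel_iff) auto
      also have "\<dots> = ln (DIM('a)) + S z" by (subst ln_mult) auto
      finally have upper: "ln (norm z) \<le> ln (DIM('a)) + S z" .
      show "norm (ln (norm z)) \<le> norm (ln (DIM('a)) + S z)"
        unfolding real_norm_def using lower upper S0 d by linarith
    qed
  qed simp
qed

text \<open>Equality almost everywhere lets \<open>g\<close> be infinite on a null set, as
  \<open>eln\<close> is on the hyperplane orthogonal to x.\<close>

lemma ereal_integral_eq_integral:
  assumes f: "integrable M f" and ae: "AE x in M. g x = ereal (f x)"
  shows "ereal_integral M g = ereal (\<integral>x. f x \<partial>M)"
proof -
  have "(\<integral>\<^sup>+x. e2ennreal (g x) \<partial>M) = (\<integral>\<^sup>+x. ennreal (f x) \<partial>M)"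
    using ae by (intro nn_integral_cong_AE) (auto elim!: eventually_mono)
  moreover have "(\<integral>\<^sup>+x. e2ennreal (- g x) \<partial>M) = (\<integral>\<^sup>+x. ennreal (- f x) \<partial>M)"
    using ae by (intro nn_integral_cong_AE) (auto elim!: eventually_mono)
  moreover have "(\<integral>\<^sup>+x. ennreal (f x) \<partial>M) \<noteq> \<infinity>" "(\<integral>\<^sup>+x. ennreal (- f x) \<partial>M) \<noteq> \<infinity>"
    using f by (auto simp: real_integrable_def)
  ultimately show ?thesis
    unfolding ereal_integral_def real_lebesgue_integral_def[OF f]
    by (cases "\<integral>\<^sup>+x. ennreal (f x) \<partial>M"; cases "\<integral>\<^sup>+x. ennreal (- f x) \<partial>M") auto
qed

text \<open>\<open>LEAST\<close> on the reals has its intended value only if a minimum exists. A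
  ball of radius e inside \<open>K\<close> makes norm x / e admissible, and the pairs of a scale up
  to that value and a point of \<open>K\<close> that represent x form a compact set.\<close>

lemma minkowski_functional_attained:
  fixes K :: "(real ^ 'n) set"
  assumes K: "compact K" and int: "0 \<in> interior K"
  shows "0 \<le> minkowski_functional K x" and "x \<in> (\<lambda>y. minkowski_functional K x *\<^sub>R y) ` K"
proof -
  obtain e where e: "0 < e" "cball 0 e \<subseteq> K"
    using int by (auto simp: mem_interior_cball)
  define P where "P a \<longleftrightarrow> 0 \<le> a \<and> x \<in> (\<lambda>y. a *\<^sub>R y) ` K" for a
  define a0 where "a0 = norm x / e"
  have "P a0"
  proof (cases "x = 0")
    case True
    have "0 \<in> K" using int interior_subset by blast
    then show ?thesis using True by (auto simp: P_def a0_def)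
  next
    case False
    then have "x = a0 *\<^sub>R ((e / norm x) *\<^sub>R x)" "(e / norm x) *\<^sub>R x \<in> K"
      using e by (auto simp: a0_def intro!: subsetD[OF e(2)])
    moreover have "0 \<le> a0" using e by (simp add: a0_def)
    ultimately show ?thesis unfolding P_def by (blast intro: image_eqI)
  qed
  define T where "T = ({0..a0} \<times> K) \<inter> {w. fst w *\<^sub>R snd w = x}"
  have "compact T"
    unfolding T_def using K
    by (intro compact_Int_closed compact_Times closed_Collect_eq continuous_intros) auto
  then have cT: "compact (fst ` T)" by (intro compact_continuous_image continuous_intros)
  have fT: "fst ` T = {a. P a \<and> a \<le> a0}"
    by (force simp: T_def P_def image_iff)
  have "fst ` T \<noteq> {}" using \<open>P a0\<close> unfolding fT by auto
  then obtain m where m: "m \<in> fst ` T" "\<And>a. a \<in> fst ` T \<Longrightarrow> m \<le> a"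
    using compact_attains_inf[OF cT] by blast
  have "minkowski_functional K x = m"
    unfolding minkowski_functional_def
  proof (rule Least_equality)
    show "0 \<le> m \<and> x \<in> (\<lambda>y. m *\<^sub>R y) ` K" using m(1) unfolding fT P_def by auto
    fix a assume "0 \<le> a \<and> x \<in> (\<lambda>y. a *\<^sub>R y) ` K"
    then have "P a" by (simp add: P_def)
    show "m \<le> a"
    proof (cases "a \<le> a0")
      case True then show ?thesis using m(2) \<open>P a\<close> unfolding fT by blast
    next
      case False then show ?thesis using m(1) unfolding fT by auto
    qed
  qed
  then show "0 \<le> minkowski_functional K x" "x \<in> (\<lambda>y. minkowski_functional K x *\<^sub>R y) ` K"
    using m(1) unfolding fT P_def by auto
qed

lemma embeds_in_L0I:
  fixes Q :: "(real ^ 'n) measure"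
  assumes Q: "prob_space Q" and sets[measurable_cong]: "sets Q = sets borel"
    and N0: "minkowski_functional K 0 = 0"
    and N: "\<And>x. x \<noteq> 0 \<Longrightarrow> 0 < minkowski_functional K x"
    and nz: "\<And>x. x \<noteq> 0 \<Longrightarrow> AE z in Q. x \<bullet> z \<noteq> 0"
    and int: "\<And>x. x \<noteq> 0 \<Longrightarrow> integrable Q (\<lambda>z. ln \<bar>x \<bullet> z\<bar>)"
    and eq: "\<And>x. x \<noteq> 0 \<Longrightarrow> (\<integral>z. ln \<bar>x \<bullet> z\<bar> \<partial>Q) = ln (minkowski_functional K x) + \<kappa>"
  shows "embeds_in_L0 K"
proof -
  interpret Q: prob_space Q by fact
  have z: "AE z in Q. z \<noteq> 0" and iz: "integrable Q (\<lambda>z. ln (norm z))"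
    using ln_norm_integrable[OF sets nz int Q] by (auto simp: nonzero_Basis)
  obtain e :: "real ^ 'n" where e: "norm e = 1" using vector_choose_size[of 1] by auto
  \<comment> \<open>The value at 0 keeps \<open>u\<close> on the sphere everywhere; almost surely z
    is not 0.\<close>
  define u where "u z = (if z = 0 then e else inverse (norm z) *\<^sub>R z)" for z
  let ?S = "restrict_space borel (sphere 0 1) :: (real ^ 'n) measure"
  have u[measurable]: "u \<in> measurable Q ?S"
  proof (rule measurable_restrict_space2)
    show "u \<in> measurable Q borel" unfolding u_def by measurable
    show "u \<in> space Q \<rightarrow> sphere 0 1" using e by (auto simp: u_def)
  qed
  define \<nu> where "\<nu> = distr Q ?S u"
  interpret \<nu>: prob_space \<nu> unfolding \<nu>_def by (rule Q.prob_space_distr) (rule u)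
  have fin: "finite_borel_measure_on_sphere \<nu>"
    unfolding finite_borel_measure_on_sphere_def
    by (simp add: \<nu>.finite_measure_axioms) (simp add: \<nu>_def)
  \<comment> \<open>From ln |(x, u z)| = ln |(x, z)| - ln |z|: integrating leaves ln of the
    functional at x, plus \<kappa>, minus the expectation of ln |z|.\<close>
  define C where "C = (\<integral>z. ln (norm z) \<partial>Q) - \<kappa>"
  have "eln (minkowski_functional K x) = ereal_integral \<nu> (\<lambda>\<xi>. eln \<bar>x \<bullet> \<xi>\<bar>) + ereal C" for x
  proof (cases "x = 0")
    \<comment> \<open>The integrand is constantly -\<infinity> and \<nu> has mass 1, so both sides
      are -\<infinity>.\<close>
    case True
    have "(\<integral>\<^sup>+\<xi>. e2ennreal (- eln \<bar>x \<bullet> \<xi>\<bar>) \<partial>\<nu>) = \<infinity>"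
      using True \<nu>.emeasure_space_1 by (simp add: eln_def)
    moreover have "(\<integral>\<^sup>+\<xi>. e2ennreal (eln \<bar>x \<bullet> \<xi>\<bar>) \<partial>\<nu>) = 0"
      using True by (simp add: eln_def e2ennreal_neg)
    ultimately show ?thesis using True N0 by (simp add: ereal_integral_def eln_def e2ennreal_neg zero_ennreal.rep_eq)
  next
    case False
    have m[measurable]: "(\<lambda>\<xi>. x \<bullet> \<xi>) \<in> borel_measurable ?S"
      by (rule measurable_restrict_space1) simp
    have ae: "AE z in Q. \<bar>x \<bullet> u z\<bar> \<noteq> 0 \<and> ln \<bar>x \<bullet> u z\<bar> = ln \<bar>x \<bullet> z\<bar> - ln (norm z)"
      using z nz[OF False]
      by eventually_elim (auto simp: u_def abs_mult ln_mult ln_inverse)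
    have "AE \<xi> in \<nu>. \<bar>x \<bullet> \<xi>\<bar> \<noteq> 0"
    proof -
      have "{\<xi> \<in> space ?S. \<bar>x \<bullet> \<xi>\<bar> \<noteq> 0} \<in> sets ?S" by measurable
      then show ?thesis
        unfolding \<nu>_def using ae by (subst AE_distr_iff[OF u]) (auto elim!: eventually_mono)
    qed
    then have ae': "AE \<xi> in \<nu>. eln \<bar>x \<bullet> \<xi>\<bar> = ereal (ln \<bar>x \<bullet> \<xi>\<bar>)"
      by eventually_elim (simp add: eln_def)
    have i: "integrable Q (\<lambda>z. ln \<bar>x \<bullet> z\<bar> - ln (norm z))"
      using int[OF False] iz by simp
    have mu[measurable]: "(\<lambda>z. ln \<bar>x \<bullet> u z\<bar>) \<in> borel_measurable Q"
      using measurable_compose[OF u m] by measurable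
    have ae_ln: "AE z in Q. ln \<bar>x \<bullet> z\<bar> - ln (norm z) = ln \<bar>x \<bullet> u z\<bar>"
      using ae by eventually_elim simp
    note mz = borel_measurable_integrable[OF i]
    have "integrable Q (\<lambda>z. ln \<bar>x \<bullet> u z\<bar>)"
      using i integrable_cong_AE[OF mz mu ae_ln] by blast
    then have i': "integrable \<nu> (\<lambda>\<xi>. ln \<bar>x \<bullet> \<xi>\<bar>)"
      unfolding \<nu>_def by (subst integrable_distr_eq) auto
    have "(\<integral>\<xi>. ln \<bar>x \<bullet> \<xi>\<bar> \<partial>\<nu>) = (\<integral>z. ln \<bar>x \<bullet> u z\<bar> \<partial>Q)"
      unfolding \<nu>_def by (subst integral_distr) auto
    also have "\<dots> = (\<integral>z. ln \<bar>x \<bullet> z\<bar> - ln (norm z) \<partial>Q)"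
      by (rule integral_cong_AE[OF mz mu ae_ln, symmetric])
    also have "\<dots> = ln (minkowski_functional K x) - C"
      using int[OF False] iz eq[OF False] by (simp add: C_def)
    finally have "ereal_integral \<nu> (\<lambda>\<xi>. eln \<bar>x \<bullet> \<xi>\<bar>) = ereal (ln (minkowski_functional K x) - C)"
      by (simp only: ereal_integral_eq_integral[OF i' ae'])
    moreover have "eln (minkowski_functional K x) = ereal (ln (minkowski_functional K x))"
      using N[OF False] by (simp add: eln_def)
    ultimately show ?thesis by simp
  qed
  with fin show ?thesis unfolding embeds_in_L0_def by blast
qed

theorem theorem6p7:
  fixes K :: "(real ^ 'n) set" and p\<^sub>0 :: real
  assumes "origin_symmetric_star_body K"
    and "0 < p\<^sub>0" and "p\<^sub>0 \<le> 2"
    and "embeds_in_Lp p\<^sub>0 K"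
  shows "embeds_in_L0 K"
proof -
  let ?N = "minkowski_functional K"
  have K: "compact K" "0 \<in> interior K"
    using assms(1) by (auto simp: origin_symmetric_star_body_def)
  note mf = minkowski_functional_attained[OF K]
  obtain \<mu> where \<mu>: "finite_measure \<mu>" "sets \<mu> = sets (restrict_space borel (sphere 0 1))"
    and rep: "\<And>x. ?N x powr p\<^sub>0 = (\<integral>\<xi>. \<bar>x \<bullet> \<xi>\<bar> powr p\<^sub>0 \<partial>\<mu>)"
    using assms(4) unfolding embeds_in_Lp_def finite_borel_measure_on_sphere_def by blast
  interpret \<mu>: finite_measure \<mu> by fact
  have N0: "?N 0 = 0" using rep[of 0] by simp
  have Npos: "0 < ?N x" if "x \<noteq> 0" for x
    using mf[of x] that by (cases "?N x = 0") auto
  \<comment> \<open>Homogeneity is read off from the integral representation; nonnegativity then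
    allows taking roots of order \<open>p\<^sub>0\<close>.\<close>
  have Nhom: "?N (t *\<^sub>R x) = \<bar>t\<bar> * ?N x" for t x
  proof -
    have "?N (t *\<^sub>R x) powr p\<^sub>0 = \<bar>t\<bar> powr p\<^sub>0 * ?N x powr p\<^sub>0"
      unfolding rep by (simp add: abs_mult powr_mult)
    also have "\<dots> = (\<bar>t\<bar> * ?N x) powr p\<^sub>0" using mf(1)[of x] by (simp add: powr_mult)
    finally have "(?N (t *\<^sub>R x) powr p\<^sub>0) powr (1 / p\<^sub>0) = ((\<bar>t\<bar> * ?N x) powr p\<^sub>0) powr (1 / p\<^sub>0)" by simp
    then show ?thesis using mf(1)[of x] mf(1)[of "t *\<^sub>R x"] assms(2) by (simp add: powr_powr)
  qed
  have space: "space \<mu> = sphere 0 1"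
    using sets_eq_imp_space_eq[OF \<mu>(2)] by (simp add: space_restrict_space)
  define m where "m = measure \<mu> (space \<mu>)"
  \<comment> \<open>A zero measure would make the functional vanish at a unit vector.\<close>
  have m: "0 < m"
  proof (rule ccontr)
    assume "\<not> 0 < m"
    then have "emeasure \<mu> (space \<mu>) = 0"
      using measure_nonneg[of \<mu> "space \<mu>"] by (simp add: m_def \<mu>.emeasure_eq_measure)
    then have ae: "AE \<xi> in \<mu>. P \<xi>" for P
      by (intro AE_I[of _ _ "space \<mu>"]) auto
    obtain e :: "real ^ 'n" where "norm e = 1" using vector_choose_size[of 1] by auto
    then have "e \<noteq> 0" by auto
    then have "0 < ?N e powr p\<^sub>0" using Npos[of e] by simp
    moreover have "?N e powr p\<^sub>0 = 0" unfolding rep by (rule integral_eq_zero_AE) (rule ae)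
    ultimately show False by simp
  qed
  \<comment> \<open>\<mu> normalised to a probability law and carried from the sphere to the whole
    space; the lost factor m reappears in the constant c / m.\<close>
  define M where "M = distr (uniform_measure \<mu> (space \<mu>)) borel (\<lambda>\<xi>. \<xi>)"
  have em: "emeasure \<mu> (space \<mu>) = ennreal m" by (simp add: m_def \<mu>.emeasure_eq_measure)
  have id[measurable]: "(\<lambda>\<xi>. \<xi>) \<in> measurable \<mu> borel"
    unfolding measurable_cong_sets[OF \<mu>(2) refl] by (rule measurable_restrict_space1) simp
  interpret U: prob_space "uniform_measure \<mu> (space \<mu>)"
    using m em by (intro prob_space_uniform_measure) auto
  have id'[measurable]: "(\<lambda>\<xi>. \<xi>) \<in> measurable (uniform_measure \<mu> (space \<mu>)) borel"
    using id by simp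
  have M: "prob_space M" "sets M = sets borel"
    unfolding M_def by (auto intro!: U.prob_space_distr id')
  have bd: "AE \<xi> in M. norm \<xi> \<le> 1"
    unfolding M_def by (subst AE_distr_iff) (auto intro!: AE_I2 simp: space)
  have intM: "(\<integral>\<xi>. \<bar>x \<bullet> \<xi>\<bar> powr p\<^sub>0 \<partial>M) = ?N x powr p\<^sub>0 / m" for x
  proof -
    have [measurable]: "(\<lambda>\<xi>. x \<bullet> \<xi>) \<in> borel_measurable \<mu>"
      by (rule measurable_compose[OF id]) simp
    have d: "1 / ennreal m = ennreal (1 / m)" using m divide_ennreal[of 1 m] by simp
    have "uniform_measure \<mu> (space \<mu>) = density \<mu> (\<lambda>\<xi>. ennreal (1 / m))"
      unfolding uniform_measure_def em by (intro density_cong) (auto simp: d)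
    then have "(\<integral>\<xi>. \<bar>x \<bullet> \<xi>\<bar> powr p\<^sub>0 \<partial>M) = (\<integral>\<xi>. 1 / m * \<bar>x \<bullet> \<xi>\<bar> powr p\<^sub>0 \<partial>\<mu>)"
      unfolding M_def using m by (subst integral_distr[OF id']) (auto simp: integral_density)
    then show ?thesis by (simp add: rep)
  qed
  obtain Q c where Q: "prob_space Q" "sets Q = sets borel" and c: "0 < c"
    and cf: "\<And>x. cf Q x = of_real (exp (- (c * (\<integral>\<xi>. \<bar>x \<bullet> \<xi>\<bar> powr p\<^sub>0 \<partial>M))))"
    using levy_law_exists[OF M bd assms(2,3)] by blast
  have "cf Q x = of_real (exp (- ((c / m) * ?N x powr p\<^sub>0)))" for x
    unfolding cf intM by simp
  from log_moments_of_law[OF Q this _ assms(2,3) Npos Nhom] c m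
  obtain \<kappa> where "\<And>x. x \<noteq> 0 \<Longrightarrow> AE z in Q. x \<bullet> z \<noteq> 0"
    "\<And>x. x \<noteq> 0 \<Longrightarrow> integrable Q (\<lambda>z. ln \<bar>x \<bullet> z\<bar>)"
    "\<And>x. x \<noteq> 0 \<Longrightarrow> (\<integral>z. ln \<bar>x \<bullet> z\<bar> \<partial>Q) = ln (?N x) + \<kappa>"
    by (metis divide_pos_pos)
  then show ?thesis using embeds_in_L0I[OF Q N0 Npos] by blast
qed

end
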